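(* Let $n\ge1$ and let $w_n\in S_{n+1}$ be the permutation with $w_n(1)=1$ and $w_n(i)=n+3-i$ for $2\le i\le n+1$. Let $\mathcal{RC}(w_n)$ be the set of rc-graphs for $w_n$. Consider the following two bijections from $\mathcal{RC}(w_n)$ to the set of partitions whose Young diagrams fit inside that of the staircase $\delta_n=(n-1,n-2,\dots,1)$: (1) $D\mapsto\lambda(D)$, where the conjugate partition of $\lambda(D)$ has as its multiset of parts (discarding zeros) the numbers $i-1$, one for each $(i,j)\in E(D)$, where $E(D)$ is the set of positions of nontrivial elbow joints of $D$; (2) $D\mapsto\mu(D)$, where $\mu(D)$ is the partition whose Young diagram is the set of boxes of the Edelman-Greene $Q$-tableau $Q(D)$ whose label equals their row number. These two bijections are the same: $\lambda(D)=\mu(D)$ for every $D\in\mathcal{RC}(w_n)$.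
   Context: An rc-graph for a permutation $w\in S_m$ is a filling of the upper-left half of an $m\times m$ array, i.e. of the positions $(i,j)$ (row $i$ counted from the top, column $j$ counted from the left) with $i,j\ge1$ and $i+j\le m+1$, by cross pieces and elbow joints. A cross piece lets one strand pass straight through horizontally (left edge to right edge) and another straight through vertically (bottom edge to top edge). An elbow joint connects the left edge to the top edge and the bottom edge to the right edge. Every position on the anti-diagonal $i+j=m+1$ is an elbow joint (a trivial one), of which only the strand from the left edge to the top edge is used. The filling must satisfy: for each $i$, the strand entering at the left of row $i$ exits at the top of column $w(i)$; and no two strands cross more than once (equivalently, there are exactly $\ell(w)$ cross pieces, where $\ell(w)$ is the number of inversions of $w$). For $D\in\mathcal{RC}(w_n)$ (so $m=n+1$), $E(D)$ is the set of positions $(i,j)$ with $i+j\le n+1$ at which $D$ has an elbow joint. Edelman-Greene correspondence. Given an rc-graph $D$, read its rows from top to bottom, each row from right to left; if the $k$-th cross piece encountered is at position $(i_k,j_k)$, set $a_k=i_k$ and $\alpha_k=i_k+j_k$. Insert $\alpha_1,\alpha_2,\dots$ successively, starting from the empty tableau, by Edelman-Greene row insertion: to insert a letter $x$ into a row, if no entry of the row is greater than $x$, append $x$ at the end of the row and stop; otherwise, if the row contains both $x$ and $x+1$, leave the row unchanged and insert $x+1$ into the next row; otherwise replace the smallest entry $y>x$ of the row by $x$ and insert $y$ into the next row. After inserting $\alpha_k$, record $a_k$ in the $Q$-tableau in the box that has just been added to the shape. At the end, transpose both the insertion tableau and the recording tableau; the results are $P(D)$ and $Q(D)$. After transposition $Q(D)$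 has weakly increasing rows and strictly increasing columns. Rows of tableaux are numbered from the top starting at $1$, and Young diagrams are drawn left- and top-justified. *)

theory Defs
  imports Main "HOL-Library.Multiset" "HOL-Combinatorics.Permutations"
begin

section \<open>Partitions\<close>

text \<open>A partition is the weakly decreasing list of its positive parts. Boxes are pairs
  (row, column), both numbered from 1.\<close>

definition is_partition :: "nat list \<Rightarrow> bool" where
  "is_partition p \<longleftrightarrow> sorted_wrt (\<ge>) p \<and> 0 \<notin> set p"

definition young_diagram :: "nat list \<Rightarrow> (nat \<times> nat) set" where
  "young_diagram p = {(r, c). 1 \<le> r \<and> r \<le> length p \<and> 1 \<le> c \<and> c \<le> p ! (r - 1)}"

definition conjugate :: "nat list \<Rightarrow> nat list" where
  "conjugate p = map (\<lambda>j. length (filter (\<lambda>x. j < x) p)) [0..<foldr max p 0]"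

definition staircase :: "nat \<Rightarrow> nat list" where
  "staircase n = rev [1..<n]"

definition partitions_in_staircase :: "nat \<Rightarrow> nat list set" where
  "partitions_in_staircase n =
    {p. is_partition p \<and> young_diagram p \<subseteq> young_diagram (staircase n)}"

lemma is_partition_Cons:
  "is_partition (x # xs) \<longleftrightarrow> (\<forall>y\<in>set xs. y \<le> x) \<and> 0 < x \<and> is_partition xs"
  by (auto simp: is_partition_def)

lemma less_length_filter_iff:
  assumes "sorted_wrt (\<ge>) p"
  shows "i < length (filter (\<lambda>x. j < x) p) \<longleftrightarrow> i < length p \<and> j < (p ! i :: nat)"
  using assms
proof (induction p arbitrary: i)
  case (Cons x xs)
  show ?case
  proof (cases "j < x")
    case True
    then show ?thesis using Cons by (cases i) auto
  next
    case False
    then have "y \<le> j" if "y \<in> set (x # xs)" for y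
      using Cons.prems that by auto
    then have "filter (\<lambda>x. j < x) (x # xs) = []"
      and "i < length (x # xs) \<longrightarrow> (x # xs) ! i \<le> j"
      using nth_mem[of i "x # xs"] by (auto simp: filter_empty_conv leD)
    then show ?thesis by (metis leD length_0_conv less_nat_zero_code)
  qed
qed simp

lemma less_foldr_max_iff: "j < foldr max p 0 \<longleftrightarrow> (\<exists>x\<in>set p. j < (x :: nat))"
  by (induction p) (auto simp: less_max_iff_disj)

lemma is_partition_conjugate: "is_partition (conjugate p)"
proof -
  have mono: "length (filter (\<lambda>x. b < x) p) \<le> length (filter (\<lambda>x. a < x) p)"
    if "a \<le> b" for a b :: nat
    using that by (induction p) auto
  have pos: "length (filter (\<lambda>x. j < x) p) \<noteq> 0" if "j < foldr max p 0" for j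
    using that by (auto simp: less_foldr_max_iff filter_empty_conv)
  have "sorted_wrt (\<ge>) (conjugate p)"
    unfolding conjugate_def sorted_wrt_iff_nth_less using mono by auto
  moreover have "0 \<notin> set (conjugate p)"
    unfolding conjugate_def using pos by fastforce
  ultimately show ?thesis by (simp add: is_partition_def)
qed

lemma young_diagram_conjugate:
  assumes "is_partition p"
  shows "(r, c) \<in> young_diagram (conjugate p) \<longleftrightarrow> (c, r) \<in> young_diagram p"
proof (cases "1 \<le> r \<and> 1 \<le> c")
  case True
  then obtain i j where rc: "r = Suc i" "c = Suc j"
    by (metis One_nat_def Suc_le_D)
  have s: "sorted_wrt (\<ge>) p" using assms by (simp add: is_partition_def)
  have "(r, c) \<in> young_diagram (conjugate p) \<longleftrightarrow>
      i < foldr max p 0 \<and> j < length (filter (\<lambda>x. i < x) p)"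
    by (auto simp: young_diagram_def conjugate_def rc)
  also have "\<dots> \<longleftrightarrow> j < length p \<and> i < p ! j"
    unfolding less_length_filter_iff[OF s] less_foldr_max_iff by (auto intro: nth_mem)
  also have "\<dots> \<longleftrightarrow> (c, r) \<in> young_diagram p"
    by (auto simp: young_diagram_def rc)
  finally show ?thesis .
qed (auto simp: young_diagram_def)

lemma young_diagram_inject:
  assumes "is_partition p" "is_partition q" "young_diagram p = young_diagram q"
  shows "p = q"
proof -
  have len: "r < length p \<longleftrightarrow> (Suc r, 1) \<in> young_diagram p" if "is_partition p" for p r
    using that by (auto simp: young_diagram_def is_partition_def Suc_le_eq)
      (metis neq0_conv nth_mem)
  have "r < length p \<longleftrightarrow> r < length q" for r
    using len[OF assms(1)] len[OF assms(2)] assms(3) by simp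
  then have l: "length p = length q" by (meson linorder_neqE_nat less_irrefl)
  moreover have "p ! r = q ! r" if "r < length p" for r
  proof -
    have nth: "c < s ! r \<longleftrightarrow> (Suc r, Suc c) \<in> young_diagram s" if "r < length s" for s c
      using that by (auto simp: young_diagram_def)
    have "c < p ! r \<longleftrightarrow> c < q ! r" for c
      using nth[of p c] nth[of q c] that l assms(3) by simp
    then show ?thesis by (meson linorder_neqE_nat less_irrefl)
  qed
  ultimately show ?thesis by (rule nth_equalityI)
qed

lemma conjugate_conjugate:
  assumes "is_partition p"
  shows "conjugate (conjugate p) = p"
proof (rule young_diagram_inject)
  show "young_diagram (conjugate (conjugate p)) = young_diagram p"
    using young_diagram_conjugate[OF assms] young_diagram_conjugate[OF is_partition_conjugate]
    by auto
qed (use assms is_partition_conjugate in auto)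


section \<open>Rc-graphs\<close>

text \<open>A filling of the positions \<open>(i, j)\<close> with \<open>i, j \<ge> 1\<close> and \<open>i + j \<le> m + 1\<close>, with elbow joints on
  the anti-diagonal \<open>i + j = m + 1\<close>, is represented by the set of its cross pieces; every other
  position holds an elbow joint.\<close>

definition nontrivial_positions :: "nat \<Rightarrow> (nat \<times> nat) set" where
  "nontrivial_positions m = {(i, j). 1 \<le> i \<and> 1 \<le> j \<and> i + j \<le> m}"

datatype edge = Left_Edge | Bottom_Edge

text \<open>\<open>strand D k i j e\<close>: the strand entering at the left of row \<open>k\<close> enters position \<open>(i, j)\<close>
  through its edge \<open>e\<close>. The bottom edge of the fictitious position \<open>(0, j)\<close> is the top of column
  \<open>j\<close> of the array.\<close>

inductive strand :: "(nat \<times> nat) set \<Rightarrow> nat \<Rightarrow> nat \<Rightarrow> nat \<Rightarrow> edge \<Rightarrow> bool"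
  for D :: "(nat \<times> nat) set" and k :: nat where
  start: "strand D k k 1 Left_Edge"
| cross_horizontal:
    "strand D k (Suc i) j Left_Edge \<Longrightarrow> (Suc i, j) \<in> D \<Longrightarrow> strand D k (Suc i) (Suc j) Left_Edge"
| cross_vertical:
    "strand D k (Suc i) j Bottom_Edge \<Longrightarrow> (Suc i, j) \<in> D \<Longrightarrow> strand D k i j Bottom_Edge"
| elbow_left_top:
    "strand D k (Suc i) j Left_Edge \<Longrightarrow> (Suc i, j) \<notin> D \<Longrightarrow> strand D k i j Bottom_Edge"
| elbow_bottom_right:
    "strand D k (Suc i) j Bottom_Edge \<Longrightarrow> (Suc i, j) \<notin> D \<Longrightarrow> strand D k (Suc i) (Suc j) Left_Edge"

definition exits_at :: "(nat \<times> nat) set \<Rightarrow> nat \<Rightarrow> nat \<Rightarrow> bool" where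
  "exits_at D k c \<longleftrightarrow> strand D k 0 c Bottom_Edge"

definition crossings :: "(nat \<times> nat) set \<Rightarrow> nat \<Rightarrow> nat \<Rightarrow> (nat \<times> nat) set" where
  "crossings D k l = {(i, j) \<in> D. (\<exists>e. strand D k i j e) \<and> (\<exists>e. strand D l i j e)}"

definition rc_graphs :: "nat \<Rightarrow> (nat \<Rightarrow> nat) \<Rightarrow> (nat \<times> nat) set set" where
  "rc_graphs m w =
    {D. D \<subseteq> nontrivial_positions m
      \<and> (\<forall>k\<in>{1..m}. exits_at D k (w k))
      \<and> (\<forall>k\<in>{1..m}. \<forall>l\<in>{1..m}. k \<noteq> l \<longrightarrow> card (crossings D k l) \<le> 1)}"

definition w_perm :: "nat \<Rightarrow> nat \<Rightarrow> nat" where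
  "w_perm n i = (if 2 \<le> i \<and> i \<le> n + 1 then n + 3 - i else i)"

lemma w_perm_permutes: "w_perm n permutes {1..n + 1}"
proof (rule bij_imp_permutes)
  have "w_perm n (w_perm n i) = i" for i
    by (auto simp: w_perm_def)
  moreover have "w_perm n i \<in> {1..n + 1}" if "i \<in> {1..n + 1}" for i
    using that by (auto simp: w_perm_def)
  ultimately show "bij_betw (w_perm n) {1..n + 1} {1..n + 1}"
    by (intro bij_betwI[where g = "w_perm n"]) auto
  show "w_perm n i = i" if "i \<notin> {1..n + 1}" for i
    using that by (auto simp: w_perm_def)
qed

abbreviation RC :: "nat \<Rightarrow> (nat \<times> nat) set set" where
  "RC n \<equiv> rc_graphs (n + 1) (w_perm n)"

definition elbows :: "nat \<Rightarrow> (nat \<times> nat) set \<Rightarrow> (nat \<times> nat) set" where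
  "elbows n D = nontrivial_positions (n + 1) - D"


section \<open>The Edelman-Greene correspondence\<close>

text \<open>Tableaux are lists of rows. \<open>eg_row_insert x R\<close> is the new row together with the letter to be
  inserted into the next row, if any. Rows of insertion tableaux are strictly increasing, so the
  \<open>map\<close> below changes a single entry.\<close>

definition eg_row_insert :: "nat \<Rightarrow> nat list \<Rightarrow> nat list \<times> nat option" where
  "eg_row_insert x R =
    (if \<forall>y\<in>set R. y \<le> x then (R @ [x], None)
     else if x \<in> set R \<and> x + 1 \<in> set R then (R, Some (x + 1))
     else let y = Min {y \<in> set R. x < y}
          in (map (\<lambda>z. if z = y then x else z) R, Some y))"

text \<open>The second component is the index, counted from 0, of the row that has grown by one box.\<close>

fun eg_insert :: "nat \<Rightarrow> nat list list \<Rightarrow> nat list list \<times> nat" where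
  "eg_insert x [] = ([[x]], 0)"
| "eg_insert x (R # T) =
    (case eg_row_insert x R of
       (R', None) \<Rightarrow> (R' # T, 0)
     | (R', Some y) \<Rightarrow> (case eg_insert y T of (T', r) \<Rightarrow> (R' # T', Suc r)))"

definition record_label :: "nat \<Rightarrow> nat \<Rightarrow> nat list list \<Rightarrow> nat list list" where
  "record_label a r Q = (if r < length Q then Q[r := Q ! r @ [a]] else Q @ [[a]])"

definition eg_step ::
    "nat \<times> nat \<Rightarrow> nat list list \<times> nat list list \<Rightarrow> nat list list \<times> nat list list" where
  "eg_step = (\<lambda>(i, j) (P, Q).
    (case eg_insert (i + j) P of (P', r) \<Rightarrow> (P', record_label i r Q)))"

text \<open>The crosses of a filling of size \<open>m\<close>, rows from top to bottom, each row from right to left.\<close>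

definition reading_order :: "nat \<Rightarrow> (nat \<times> nat) set \<Rightarrow> (nat \<times> nat) list" where
  "reading_order m D =
    filter (\<lambda>p. p \<in> D) (concat (map (\<lambda>i. map (\<lambda>j. (i, j)) (rev [1..<m + 1])) [1..<m + 1]))"

definition EG :: "nat \<Rightarrow> (nat \<times> nat) set \<Rightarrow> nat list list \<times> nat list list" where
  "EG m D = (case fold eg_step (reading_order m D) ([], []) of
    (P, Q) \<Rightarrow> (List.transpose P, List.transpose Q))"

definition Q_tableau :: "nat \<Rightarrow> (nat \<times> nat) set \<Rightarrow> nat list list" where
  "Q_tableau m D = snd (EG m D)"


section \<open>The two maps\<close>

definition elbow_parts :: "nat \<Rightarrow> (nat \<times> nat) set \<Rightarrow> nat multiset" where
  "elbow_parts n D =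
    filter_mset (\<lambda>x. 0 < x) (image_mset (\<lambda>(i, j). i - 1) (mset_set (elbows n D)))"

definition rc_lambda :: "nat \<Rightarrow> (nat \<times> nat) set \<Rightarrow> nat list" where
  "rc_lambda n D = conjugate (rev (sorted_list_of_multiset (elbow_parts n D)))"

lemma
  shows is_partition_rc_lambda: "is_partition (rc_lambda n D)"
    and mset_conjugate_rc_lambda: "mset (conjugate (rc_lambda n D)) = elbow_parts n D"
proof -
  let ?q = "rev (sorted_list_of_multiset (elbow_parts n D))"
  have "is_partition ?q"
    by (auto simp: is_partition_def sorted_wrt_rev elbow_parts_def)
  then show "mset (conjugate (rc_lambda n D)) = elbow_parts n D"
    by (simp add: rc_lambda_def conjugate_conjugate)
qed (simp add: rc_lambda_def is_partition_conjugate)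

definition row_label_boxes :: "nat list list \<Rightarrow> (nat \<times> nat) set" where
  "row_label_boxes T =
    {(r, c). 1 \<le> r \<and> r \<le> length T \<and> 1 \<le> c \<and> c \<le> length (T ! (r - 1))
      \<and> T ! (r - 1) ! (c - 1) = r}"

text \<open>A partition is determined by its Young diagram (young_diagram_inject); the description is
  meaningful only for those fillings whose set of boxes is a Young diagram.\<close>

definition rc_mu :: "nat \<Rightarrow> (nat \<times> nat) set \<Rightarrow> nat list" where
  "rc_mu n D =
    (THE p. is_partition p \<and> young_diagram p = row_label_boxes (Q_tableau (n + 1) D))"

end

(* An rc-graph of w_n is the complement of a triangulation: reading the cell (i, j) as the segment
   between the vertices i - 1 and n + 2 - j of a polygon with the vertices 0, ..., n + 1, every strand
   except the first one turns at least three times, and counting turns and crossings leaves room for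
   exactly three turns, at the sides of a triangle. A triangulation is determined by the number of
   segments starting at each vertex, which is the data of lambda(D).

   The reading word of D is reduced, so Edelman-Greene insertion produces a tableau with strictly
   increasing rows and columns; its size and the range of its entries force it to be the staircase
   tableau. The letters of the rows below r are at least r + 2 and do not move the entries smaller than
   r + i + 1 in the i-th row, while a single row of D lengthens the first row of the tableau by at most
   one box. Hence after r rows of D the first r - 1 columns are complete and the others, except for the
   r-th, are empty, and the length of the r-th column is found by counting crosses. *)
theory Submission
  imports Defs
begin

section \<open>Strands\<close>

text \<open>There are n(n+1)/2 nontrivial positions. The strands 2, ..., n+1 leave in reversed
  order, so each of their n(n-1)/2 pairs crosses, and at most n elbows remain. Conversely, the exit
  column n+3-k of strand k lies beyond the anti-diagonal of row k, so one turn is not enough; a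
  strand enters horizontally and leaves vertically, so it makes at least three turns. With e elbows
  there are 2e+n entry edges for these turns, whence 3n \<le> 2e+n and e = n. The count starts from
  the exits alone and excludes double crossings by itself, so for the way back from a triangulation
  it suffices to trace the strands. That reversed strands cross is a planarity statement. It comes
  from a sweep through the array that keeps the order of the strands along a frontier; the same
  sweep shows that the inserted word is reduced. A triangulation is rebuilt from its last vertex
  backwards. The neighbours of a new vertex form an initial part of the chain that the later
  vertices leave exposed, so their number determines them. The staircase condition says that this
  chain is always long enough.\<close>

lemma strand_bounds:
  assumes "strand D k i j e"
  shows "1 \<le> j \<and> i \<le> k \<and> (e = Bottom_Edge \<longrightarrow> i < k)"
  using assms by induction auto

text \<open>Anti-diagonal cells hold elbows, so a strand that reaches one from the left turns up,
  and none enters such a cell from below.\<close>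

lemma strand_antidiagonal:
  assumes "strand D k i j e" "D \<subseteq> nontrivial_positions m" "k \<le> m"
  shows "i + j \<le> m + 1 \<and> (e = Bottom_Edge \<longrightarrow> i + j \<le> m)"
  using assms by induction (auto simp: nontrivial_positions_def)

text \<open>Strands can be traced backwards: whether the cell behind an edge is in \<open>D\<close>
  decides by which rule the edge was reached. A start edge has no predecessor, since columns are
  numbered from 1.\<close>

lemma strand_unique:
  assumes "strand D k i j e" "strand D l i j e"
  shows "k = l"
  using assms
proof (induction arbitrary: l)
  case start
  then show ?case
  proof cases
    case (cross_horizontal i j)
    then show ?thesis using strand_bounds[OF cross_horizontal(3)] by simp
  next
    case (elbow_bottom_right i j)
    then show ?thesis using strand_bounds[OF elbow_bottom_right(3)] by simp
  qed auto
next
  case (cross_horizontal i j)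
  have "1 \<le> j" using strand_bounds[OF cross_horizontal.hyps(1)] by simp
  with cross_horizontal.hyps(2) have "strand D l (Suc i) j Left_Edge"
    by (cases rule: strand.cases[OF cross_horizontal.prems]) auto
  then show ?case by (rule cross_horizontal.IH)
next
  case (cross_vertical i j)
  then have "strand D l (Suc i) j Bottom_Edge"
    by (cases rule: strand.cases[OF cross_vertical.prems]) auto
  then show ?case by (rule cross_vertical.IH)
next
  case (elbow_left_top i j)
  then have "strand D l (Suc i) j Left_Edge"
    by (cases rule: strand.cases[OF elbow_left_top.prems]) auto
  then show ?case by (rule elbow_left_top.IH)
next
  case (elbow_bottom_right i j)
  have "1 \<le> j" using strand_bounds[OF elbow_bottom_right.hyps(1)] by simp
  with elbow_bottom_right.hyps(2) have "strand D l (Suc i) j Bottom_Edge"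
    by (cases rule: strand.cases[OF elbow_bottom_right.prems]) auto
  then show ?case by (rule elbow_bottom_right.IH)
qed

lemma strand_horizontal:
  assumes "strand D k i j Left_Edge" "j \<le> j'" "\<And>y. j \<le> y \<Longrightarrow> y < j' \<Longrightarrow> (i, y) \<in> D" "1 \<le> i"
  shows "strand D k i j' Left_Edge"
  using assms(2,3)
proof (induction j' rule: dec_induct)
  case base
  show ?case using assms(1) .
next
  case (step y)
  then show ?case using assms(4) strand.cross_horizontal[of D k "i - 1" y] by simp
qed

lemma strand_vertical:
  assumes "strand D k i j Bottom_Edge" "i' \<le> i" "\<And>x. i' < x \<Longrightarrow> x \<le> i \<Longrightarrow> (x, j) \<in> D"
  shows "strand D k i' j Bottom_Edge"
  using assms(2,3)
proof (induction rule: inc_induct)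
  case base
  show ?case using assms(1) .
next
  case (step x)
  then show ?case using strand.cross_vertical[of D k x j] by simp
qed

lemma horizontal_run:
  assumes "strand D k i j Left_Edge" "finite D" "1 \<le> i"
  obtains j' where "j \<le> j'" "(i, j') \<notin> D" "\<And>y. j \<le> y \<Longrightarrow> y < j' \<Longrightarrow> (i, y) \<in> D"
    "strand D k i j' Left_Edge"
proof -
  have "\<exists>y\<ge>j. (i, y) \<notin> D"
  proof (rule ccontr)
    assume "\<not> ?thesis"
    then have "Pair i ` {j..} \<subseteq> D" by auto
    then have "finite (Pair i ` {j..})" using assms(2) finite_subset by blast
    then show False by (auto simp: finite_image_iff inj_on_def infinite_Ici)
  qed
  then obtain y where y: "j \<le> y" "(i, y) \<notin> D" by blast
  define j' where "j' = (LEAST y. j \<le> y \<and> (i, y) \<notin> D)"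
  have 1: "j \<le> j' \<and> (i, j') \<notin> D" unfolding j'_def by (rule LeastI) (use y in blast)
  have 2: "(i, y) \<in> D" if "j \<le> y" "y < j'" for y
    using not_less_Least that unfolding j'_def by blast
  show ?thesis using that[of j'] 1 2 strand_horizontal[OF assms(1) _ 2 assms(3)] by blast
qed

lemma vertical_run:
  assumes "strand D k i j Bottom_Edge"
  obtains (elbow) i' where "1 \<le> i'" "i' \<le> i" "(i', j) \<notin> D"
      "\<And>x. i' < x \<Longrightarrow> x \<le> i \<Longrightarrow> (x, j) \<in> D" "strand D k i' j Bottom_Edge"
  | (exit) "\<And>x. 1 \<le> x \<Longrightarrow> x \<le> i \<Longrightarrow> (x, j) \<in> D" "strand D k 0 j Bottom_Edge"
proof (cases "\<exists>x. 1 \<le> x \<and> x \<le> i \<and> (x, j) \<notin> D")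
  case True
  define i' where "i' = (GREATEST x. 1 \<le> x \<and> x \<le> i \<and> (x, j) \<notin> D)"
  have 1: "1 \<le> i' \<and> i' \<le> i \<and> (i', j) \<notin> D"
    unfolding i'_def by (rule GreatestI_ex_nat[OF True, of i]) auto
  have 2: "(x, j) \<in> D" if "i' < x" "x \<le> i" for x
  proof (rule ccontr)
    assume "(x, j) \<notin> D"
    then have "x \<le> i'" unfolding i'_def using that by (intro Greatest_le_nat[of _ _ i]) auto
    then show False using that by simp
  qed
  show ?thesis using elbow[of i'] 1 2 strand_vertical[OF assms _ 2] by blast
next
  case False
  then have "\<And>x. 1 \<le> x \<Longrightarrow> x \<le> i \<Longrightarrow> (x, j) \<in> D" by blast
  moreover from this have "strand D k 0 j Bottom_Edge" using strand_vertical[OF assms, of 0] by auto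
  ultimately show ?thesis using exit by blast
qed

lemma elbow_up:
  assumes "strand D k i j Left_Edge" "(i, j) \<notin> D" "1 \<le> i"
  shows "strand D k (i - 1) j Bottom_Edge"
  using assms strand.elbow_left_top[of D k "i - 1" j] by simp

lemma elbow_right:
  assumes "strand D k i j Bottom_Edge" "(i, j) \<notin> D" "1 \<le> i"
  shows "strand D k i (Suc j) Left_Edge"
  using assms strand.elbow_bottom_right[of D k "i - 1" j] by simp

lemma finite_nontrivial_positions: "finite (nontrivial_positions m)"
  by (rule finite_subset[of _ "{1..m} \<times> {1..m}"]) (auto simp: nontrivial_positions_def)

section \<open>Sweeping the array: the order of the strands along a frontier\<close>

definition swap :: "(nat \<Rightarrow> nat) \<Rightarrow> nat \<Rightarrow> nat \<Rightarrow> nat" where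
  "swap g x = g(x := g (Suc x), Suc x := g x)"

fun ascending :: "(nat \<Rightarrow> nat) \<Rightarrow> nat list \<Rightarrow> bool" where
  "ascending g [] \<longleftrightarrow> True"
| "ascending g (x # xs) \<longleftrightarrow> g x < g (Suc x) \<and> ascending (swap g x) xs"

lemma ascending_append:
  "ascending g (xs @ ys) \<longleftrightarrow> ascending g xs \<and> ascending (foldl swap g xs) ys"
  by (induction xs arbitrary: g) auto

text \<open>The sweep runs through the rows from bottom to top and through each row from left to right.
  When it is about to process the cell \<open>(i, j)\<close>, the left edge of that cell is number \<open>i + j\<close> on the
  frontier and its bottom edge is number \<open>i + j + 1\<close>; the value of \<open>g\<close> at a number is the strand
  through the corresponding edge.\<close>

definition frontier_edge :: "nat \<Rightarrow> nat \<Rightarrow> nat \<Rightarrow> nat \<times> nat \<times> edge" where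
  "frontier_edge i j p =
    (if p \<le> i then (p - 1, 1, Left_Edge)
     else if p < i + j then (i - 1, p - i, Bottom_Edge)
     else if p = i + j then (i, j, Left_Edge)
     else (i, p - 1 - i, Bottom_Edge))"

definition swept :: "nat \<Rightarrow> nat \<Rightarrow> (nat \<times> nat) set" where
  "swept i j = {(x, y). i < x \<or> x = i \<and> y < j}"

text \<open>The last clause serves twice: an inversion on the final frontier yields a crossing of
  two strands, and a cross met by an already inverted pair would be their second crossing.\<close>

definition frontier :: "nat \<Rightarrow> (nat \<times> nat) set \<Rightarrow> nat \<Rightarrow> nat \<Rightarrow> (nat \<Rightarrow> nat) \<Rightarrow> bool" where
  "frontier m D i j g \<longleftrightarrow>
    (\<forall>p\<in>{2..m + 1}. case frontier_edge i j p of (x, y, e) \<Rightarrow> strand D (g p) x y e) \<and>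
    inj_on g {2..m + 1} \<and> g ` {2..m + 1} \<subseteq> {1..m} \<and>
    (\<forall>p q. 2 \<le> p \<and> p < q \<and> q \<le> m + 1 \<and> g q < g p \<longrightarrow>
      crossings D (g p) (g q) \<inter> swept i j \<noteq> {})"

lemma frontier_strand:
  assumes "frontier m D i j g" "p \<in> {2..m + 1}"
  shows "case frontier_edge i j p of (x, y, e) \<Rightarrow> strand D (g p) x y e"
  using assms unfolding frontier_def by (elim conjE) (erule (1) bspec)

lemma frontier_crossings:
  assumes "frontier m D i j g" "2 \<le> p" "p < q" "q \<le> m + 1" "g q < g p"
  shows "crossings D (g p) (g q) \<inter> swept i j \<noteq> {}"
  using assms by (auto simp: frontier_def)

lemma frontierI:
  assumes "\<And>p. p \<in> {2..m + 1} \<Longrightarrow> case frontier_edge i j p of (x, y, e) \<Rightarrow> strand D (g p) x y e"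
    and "inj_on g {2..m + 1}" and "g ` {2..m + 1} \<subseteq> {1..m}"
    and "\<And>p q. 2 \<le> p \<Longrightarrow> p < q \<Longrightarrow> q \<le> m + 1 \<Longrightarrow> g q < g p \<Longrightarrow>
      crossings D (g p) (g q) \<inter> swept i j \<noteq> {}"
  shows "frontier m D i j g"
  unfolding frontier_def using assms by (intro conjI ballI allI impI) (assumption | (elim conjE))+

lemma crossings_commute: "crossings D k l = crossings D l k"
  by (auto simp: crossings_def)

text \<open>After the cell, number \<open>i + j\<close> is its top edge and number
  \<open>i + j + 1\<close> its right edge. An elbow leads left to top and bottom to right, so the
  labels stay; a cross exchanges them.\<close>

lemma frontier_cell:
  assumes f: "frontier m D i j g" and D: "D \<subseteq> nontrivial_positions m" and i: "1 \<le> i" and j: "1 \<le> j"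
  shows "frontier m D i (Suc j) (if (i, j) \<in> D then swap g (i + j) else g)"
proof (cases "(i, j) \<in> D")
  case True
  then have ij: "i + j \<le> m" using D by (auto simp: nontrivial_positions_def)
  let ?x = "i + j"
  have str: "case frontier_edge i j p of (x, y, e) \<Rightarrow> strand D (g p) x y e" if "p \<in> {2..m+1}" for p
    using frontier_strand[OF f that] .
  have L: "strand D (g ?x) i j Left_Edge"
    using str[of ?x] i j ij by (auto simp: frontier_edge_def)
  have B: "strand D (g (Suc ?x)) i j Bottom_Edge"
    using str[of "Suc ?x"] i j ij by (auto simp: frontier_edge_def)
  have L': "strand D (g ?x) i (Suc j) Left_Edge"
    using strand.cross_horizontal[of D _ "i - 1" j] L True i by simp
  have B': "strand D (g (Suc ?x)) (i - 1) j Bottom_Edge"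
    using strand.cross_vertical[of D _ "i - 1" j] B True i by simp
  have inj: "inj_on g {2..m+1}" and im: "g ` {2..m+1} \<subseteq> {1..m}" using f by (auto simp: frontier_def)
  have inv: "crossings D (g p) (g q) \<inter> swept i j \<noteq> {}" if "2 \<le> p" "p < q" "q \<le> m+1" "g q < g p" for p q
    using f that by (auto simp: frontier_def)
  have sw: "swept i j \<subseteq> swept i (Suc j)" by (auto simp: swept_def)
  have new: "(i, j) \<in> crossings D (g (Suc ?x)) (g ?x) \<inter> swept i (Suc j)"
    using L B True by (auto simp: crossings_def swept_def)
  have "case frontier_edge i (Suc j) p of (x, y, e) \<Rightarrow> strand D (swap g ?x p) x y e"
    if p: "p \<in> {2..m+1}" for p
  proof -
    consider "p = ?x" | "p = Suc ?x" | "p \<noteq> ?x" "p \<noteq> Suc ?x" by blast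
    then show ?thesis
    proof cases
      case 1 then show ?thesis using B' i j by (auto simp: frontier_edge_def swap_def)
    next
      case 2 then show ?thesis using L' i j by (auto simp: frontier_edge_def swap_def)
    next
      case 3
      then have "frontier_edge i (Suc j) p = frontier_edge i j p" by (auto simp: frontier_edge_def)
      then show ?thesis using str[OF p] 3 by (simp add: swap_def)
    qed
  qed
  moreover have "inj_on (swap g ?x) {2..m+1}"
  proof (rule inj_onI)
    fix p q assume pq: "p \<in> {2..m+1}" "q \<in> {2..m+1}" "swap g ?x p = swap g ?x q"
    define t where "t z = (if z = ?x then Suc ?x else if z = Suc ?x then ?x else z)" for z
    have "g (t p) = g (t q)" using pq(3) by (simp add: swap_def t_def split: if_splits)
    moreover have "t p \<in> {2..m+1}" "t q \<in> {2..m+1}" using pq i j ij by (auto simp: t_def)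
    ultimately have "t p = t q" using inj inj_onD by metis
    then show "p = q" by (auto simp: t_def split: if_splits)
  qed
  moreover have "swap g ?x ` {2..m+1} \<subseteq> {1..m}"
  proof -
    have "swap g ?x p \<in> {1..m}" if "p \<in> {2..m+1}" for p
      using im i j ij that by (simp add: swap_def image_subset_iff)
    then show ?thesis by blast
  qed
  moreover have "crossings D (swap g ?x p) (swap g ?x q) \<inter> swept i (Suc j) \<noteq> {}"
    if pq: "2 \<le> p" "p < q" "q \<le> m+1" "swap g ?x q < swap g ?x p" for p q
  proof -
    \<comment> \<open>\<open>t\<close> is the transposition of the two frontier places. It preserves
      the order of every pair except the swapped one, so every other inversion was there
      before.\<close>
    define t where "t z = (if z = ?x then Suc ?x else if z = Suc ?x then ?x else z)" for z
    have sg: "swap g ?x z = g (t z)" for z by (simp add: swap_def t_def)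
    show ?thesis
    proof (cases "p = ?x \<and> q = Suc ?x")
      case True
      then show ?thesis using new by (auto simp: swap_def)
    next
      case False
      then have "2 \<le> t p" "t p < t q" "t q \<le> m + 1" using pq i j ij by (auto simp: t_def)
      from inv[OF this] show ?thesis using pq(4) sw unfolding sg by blast
    qed
  qed
  ultimately show ?thesis using True unfolding frontier_def by auto
next
  case False
  have str: "case frontier_edge i j p of (x, y, e) \<Rightarrow> strand D (g p) x y e" if "p \<in> {2..m+1}" for p
    using frontier_strand[OF f that] .
  have "case frontier_edge i (Suc j) p of (x, y, e) \<Rightarrow> strand D (g p) x y e"
    if p: "p \<in> {2..m+1}" for p
  proof -
    consider "p = i + j" | "p = Suc (i + j)" | "p \<noteq> i + j" "p \<noteq> Suc (i + j)" by blast
    then show ?thesis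
    proof cases
      case 1 then show ?thesis using str[OF p] elbow_up[of D "g p" i j] False i j by (auto simp: frontier_edge_def)
    next
      case 2 then show ?thesis using str[OF p] elbow_right[of D "g p" i j] False i j by (auto simp: frontier_edge_def)
    next
      case 3
      then have "frontier_edge i (Suc j) p = frontier_edge i j p" by (auto simp: frontier_edge_def)
      then show ?thesis using str[OF p] by simp
    qed
  qed
  moreover
  have "swept i j \<subseteq> swept i (Suc j)" by (auto simp: swept_def)
  then have "crossings D (g p) (g q) \<inter> swept i (Suc j) \<noteq> {}"
    if "2 \<le> p" "p < q" "q \<le> m + 1" "g q < g p" for p q
    using frontier_crossings[OF f that] by blast
  ultimately show ?thesis using f False by (simp add: frontierI frontier_def)
qed

text \<open>If the two labels were inverted already, the invariant would supply a crossing of these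
  strands among the swept cells, and the cell itself would be another one.\<close>

lemma frontier_ascent:
  assumes f: "frontier m D i j g" and D: "D \<subseteq> nontrivial_positions m" and i: "1 \<le> i" and j: "1 \<le> j"
    and one: "\<And>k l. k \<in> {1..m} \<Longrightarrow> l \<in> {1..m} \<Longrightarrow> k \<noteq> l \<Longrightarrow> card (crossings D k l) \<le> 1"
    and c: "(i, j) \<in> D"
  shows "g (i + j) < g (Suc (i + j))"
proof (rule ccontr)
  let ?x = "i + j"
  assume n: "\<not> g ?x < g (Suc ?x)"
  have ij: "i + j \<le> m" using c D by (auto simp: nontrivial_positions_def)
  have str: "case frontier_edge i j p of (x, y, e) \<Rightarrow> strand D (g p) x y e" if "p \<in> {2..m+1}" for p
    using frontier_strand[OF f that] .
  have L: "strand D (g ?x) i j Left_Edge"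
    using str[of ?x] i j ij by (auto simp: frontier_edge_def)
  have B: "strand D (g (Suc ?x)) i j Bottom_Edge"
    using str[of "Suc ?x"] i j ij by (auto simp: frontier_edge_def)
  have x: "?x \<in> {2..m+1}" "Suc ?x \<in> {2..m+1}" using i j ij by auto
  have ne: "g ?x \<noteq> g (Suc ?x)"
    using f x unfolding frontier_def inj_on_def by (metis n_not_Suc_n)
  then have "crossings D (g ?x) (g (Suc ?x)) \<inter> swept i j \<noteq> {}"
    using f n x unfolding frontier_def by auto
  then obtain z where z: "z \<in> crossings D (g ?x) (g (Suc ?x))" "z \<in> swept i j" by blast
  have "(i, j) \<in> crossings D (g ?x) (g (Suc ?x))" using L B c by (auto simp: crossings_def)
  moreover have "z \<noteq> (i, j)" using z by (auto simp: swept_def)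
  moreover have "finite (crossings D (g ?x) (g (Suc ?x)))"
    by (rule finite_subset[OF _ finite_subset[OF D finite_nontrivial_positions]]) (auto simp: crossings_def)
  ultimately have "2 \<le> card (crossings D (g ?x) (g (Suc ?x)))"
    using z card_mono[of "crossings D (g ?x) (g (Suc ?x))" "{z, (i, j)}"] by simp
  moreover have "g ` {2..m+1} \<subseteq> {1..m}" using f by (simp add: frontier_def)
  then have "g ?x \<in> {1..m}" "g (Suc ?x) \<in> {1..m}" using x by blast+
  ultimately show False using one[of "g ?x" "g (Suc ?x)"] ne by simp
qed

definition row_letters :: "(nat \<times> nat) set \<Rightarrow> nat \<Rightarrow> nat \<Rightarrow> nat list" where
  "row_letters D i j = map (\<lambda>y. i + y) (filter (\<lambda>y. (i, y) \<in> D) [1..<j])"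

definition sweep_letters :: "nat \<Rightarrow> (nat \<times> nat) set \<Rightarrow> nat list" where
  "sweep_letters m D = concat (map (\<lambda>i. row_letters D i (m + 1)) (rev [1..<m + 1]))"

lemma frontier_row:
  assumes f: "frontier m D i 1 g" and D: "D \<subseteq> nontrivial_positions m" and i: "1 \<le> i" and j: "1 \<le> j"
  shows "frontier m D i j (foldl swap g (row_letters D i j))"
  using j
proof (induction j rule: dec_induct)
  case base
  then show ?case using f by (simp add: row_letters_def)
next
  case (step y)
  then show ?case using frontier_cell[OF step.IH D i step.hyps(1)]
    by (auto simp: row_letters_def split: if_splits)
qed

lemma ascending_row:
  assumes f: "frontier m D i 1 g" and D: "D \<subseteq> nontrivial_positions m" and i: "1 \<le> i" and j: "1 \<le> j"
    and one: "\<And>k l. k \<in> {1..m} \<Longrightarrow> l \<in> {1..m} \<Longrightarrow> k \<noteq> l \<Longrightarrow> card (crossings D k l) \<le> 1"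
  shows "ascending g (row_letters D i j)"
  using j
proof (induction j rule: dec_induct)
  case base
  then show ?case by (simp add: row_letters_def)
next
  case (step y)
  then show ?case
    using frontier_ascent[OF frontier_row[OF f D i step.hyps(1)] D i step.hyps(1) one]
    by (auto simp: row_letters_def ascending_append)
qed

lemma frontier_next_row:
  assumes "frontier m D (Suc i) (m + 1) g"
  shows "frontier m D i 1 g"
proof -
  have "frontier_edge (Suc i) (m + 1) p = frontier_edge i 1 p" if "p \<in> {2..m+1}" for p
    using that by (auto simp: frontier_edge_def)
  moreover have "crossings D k l \<inter> swept (Suc i) (m + 1) \<subseteq> crossings D k l \<inter> swept i 1" for k l
    by (auto simp: swept_def)
  then have "crossings D (g p) (g q) \<inter> swept i 1 \<noteq> {}"
    if "2 \<le> p" "p < q" "q \<le> m + 1" "g q < g p" for p q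
    using frontier_crossings[OF assms that] by blast
  ultimately show ?thesis using assms by (simp add: frontierI frontier_def)
qed

text \<open>The two conclusions are kept apart because the first is applied to fillings whose
  crossings are not yet known to be single.\<close>

lemma sweep_rows:
  assumes D: "D \<subseteq> nontrivial_positions m" and i: "i \<le> m"
  defines "w \<equiv> concat (map (\<lambda>i. row_letters D i (m + 1)) (rev [Suc i..<m + 1]))"
  shows "frontier m D i 1 (foldl swap (\<lambda>p. p - 1) w)"
    and "(\<And>k l. k \<in> {1..m} \<Longrightarrow> l \<in> {1..m} \<Longrightarrow> k \<noteq> l \<Longrightarrow> card (crossings D k l) \<le> 1) \<Longrightarrow>
      ascending (\<lambda>p. p - 1) w"
proof -
  have "frontier m D i 1 (foldl swap (\<lambda>p. p - 1) w) \<and>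
   ((\<forall>k l. k \<in> {1..m} \<longrightarrow> l \<in> {1..m} \<longrightarrow> k \<noteq> l \<longrightarrow> card (crossings D k l) \<le> 1) \<longrightarrow>
      ascending (\<lambda>p. p - 1) w)"
    unfolding w_def using i
  proof (induction rule: inc_induct)
    case base
    have "case frontier_edge m 1 p of (x, y, e) \<Rightarrow> strand D (p - 1) x y e" if "p \<in> {2..m+1}" for p
      using that strand.start[of D "p - 1"] by (cases "p = Suc m") (auto simp: frontier_edge_def)
    then show ?case by (auto simp: frontier_def inj_on_def)
  next
    case (step i)
    let ?g = "foldl swap (\<lambda>p. p - 1) (concat (map (\<lambda>i. row_letters D i (m + 1)) (rev [Suc (Suc i)..<m + 1])))"
    have eq: "[Suc i..<m + 1] = Suc i # [Suc (Suc i)..<m+1]" using step by (simp add: upt_rec)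
    have f: "frontier m D (Suc i) 1 ?g" using step by blast
    have "frontier m D i 1 (foldl swap ?g (row_letters D (Suc i) (m + 1)))"
      by (intro frontier_next_row frontier_row f D) auto
    moreover have "ascending ?g (row_letters D (Suc i) (m + 1))"
      if "\<forall>k l. k \<in> {1..m} \<longrightarrow> l \<in> {1..m} \<longrightarrow> k \<noteq> l \<longrightarrow> card (crossings D k l) \<le> 1"
      by (rule ascending_row[OF f D]) (use that in auto)
    ultimately show ?case using step.IH unfolding eq by (auto simp: ascending_append)
  qed
  then show "frontier m D i 1 (foldl swap (\<lambda>p. p - 1) w)"
    and "(\<And>k l. k \<in> {1..m} \<Longrightarrow> l \<in> {1..m} \<Longrightarrow> k \<noteq> l \<Longrightarrow> card (crossings D k l) \<le> 1) \<Longrightarrow>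
      ascending (\<lambda>p. p - 1) w" by blast+
qed

lemma ascending_sweep:
  assumes "D \<in> rc_graphs m w"
  shows "ascending (\<lambda>p. p - 1) (sweep_letters m D)"
  using sweep_rows(2)[of D m 0] assms by (simp add: sweep_letters_def rc_graphs_def)

text \<open>At the end of the sweep the frontier is the top of the array, where column
  \<open>c\<close> has number \<open>Suc c\<close>.\<close>

lemma sweep_exits:
  assumes D: "D \<subseteq> nontrivial_positions m"
  shows "\<exists>g. (\<forall>c\<in>{1..m}. exits_at D (g (Suc c)) c) \<and> inj_on g {2..m + 1} \<and>
    (\<forall>p q. 2 \<le> p \<longrightarrow> p < q \<longrightarrow> q \<le> m + 1 \<longrightarrow> g q < g p \<longrightarrow> crossings D (g p) (g q) \<noteq> {})"
proof -
  define g where "g = foldl swap (\<lambda>p. p - 1) (sweep_letters m D)"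
  have f: "frontier m D 0 1 g" unfolding g_def sweep_letters_def using sweep_rows(1)[OF D, of 0] by simp
  have "exits_at D (g (Suc c)) c" if "c \<in> {1..m}" for c
    using frontier_strand[OF f, of "Suc c"] that by (auto simp: frontier_edge_def exits_at_def)
  moreover have "crossings D (g p) (g q) \<noteq> {}" if "2 \<le> p" "p < q" "q \<le> m + 1" "g q < g p" for p q
    using frontier_crossings[OF f that] by blast
  moreover have "inj_on g {2..m + 1}" using f by (simp add: frontier_def)
  ultimately show ?thesis by blast
qed

lemma exits_at_range:
  assumes "exits_at D k c" "D \<subseteq> nontrivial_positions m" "k \<le> m"
  shows "c \<in> {1..m}"
  using strand_bounds strand_antidiagonal[OF _ assms(2,3)] assms(1)
  unfolding exits_at_def by fastforce

lemma exits_at_unique: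
  assumes D: "D \<subseteq> nontrivial_positions m" and "k \<le> m" "exits_at D k c" "exits_at D k c'"
  shows "c = c'"
proof -
  obtain g where g: "\<forall>c\<in>{1..m}. exits_at D (g (Suc c)) c" "inj_on g {2..m + 1}"
    "\<forall>p q. 2 \<le> p \<longrightarrow> p < q \<longrightarrow> q \<le> m + 1 \<longrightarrow> g q < g p \<longrightarrow> crossings D (g p) (g q) \<noteq> {}"
    using sweep_exits[OF D] by blast
  have c: "c \<in> {1..m}" "c' \<in> {1..m}" using assms exits_at_range by blast+
  have "g (Suc c) = k" "g (Suc c') = k"
    using g(1) c assms(3,4) strand_unique unfolding exits_at_def by blast+
  moreover have "Suc c \<in> {2..m+1}" "Suc c' \<in> {2..m+1}" using c by auto
  ultimately show ?thesis using g(2) by (metis inj_onD Suc_inject)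
qed

lemma reversed_strands_cross:
  assumes D: "D \<subseteq> nontrivial_positions m" and "k < l" "l \<le> m" "exits_at D k c" "exits_at D l c'" "c' < c"
  shows "crossings D k l \<noteq> {}"
proof -
  obtain g where g: "\<forall>c\<in>{1..m}. exits_at D (g (Suc c)) c" "inj_on g {2..m + 1}"
    "\<forall>p q. 2 \<le> p \<longrightarrow> p < q \<longrightarrow> q \<le> m + 1 \<longrightarrow> g q < g p \<longrightarrow> crossings D (g p) (g q) \<noteq> {}"
    using sweep_exits[OF D] by blast
  have c: "c \<in> {1..m}" "c' \<in> {1..m}" using assms exits_at_range[OF _ D] by (meson less_imp_le order_trans)+
  have "g (Suc c) = k" "g (Suc c') = l"
    using g(1) c assms(4,5) strand_unique unfolding exits_at_def by blast+
  then show ?thesis using g(3)[rule_format, of "Suc c'" "Suc c"] c assms(2,6) crossings_commute[of D k l] by auto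
qed

section \<open>Counting crossings, elbows and turns\<close>

definition strand_pairs :: "nat \<Rightarrow> (nat \<times> nat) set" where
  "strand_pairs n = {(k, l). 2 \<le> k \<and> k < l \<and> l \<le> n + 1}"

lemma finite_strand_pairs: "finite (strand_pairs n)"
  by (rule finite_subset[of _ "{..n + 1} \<times> {..n + 1}"]) (auto simp: strand_pairs_def)

lemma card_nontrivial_positions:
  "card (nontrivial_positions (n + 1)) = card (strand_pairs n) + n"
proof -
  have "strand_pairs n = (SIGMA k:{2..n + 1}. {k<..n + 1})" by (auto simp: strand_pairs_def)
  then have p: "card (strand_pairs n) = (\<Sum>k\<in>{2..n + 1}. n + 1 - k)" by simp
  have "nontrivial_positions (n + 1) = (SIGMA i:{1..n + 1}. {1..n + 1 - i})"
    by (auto simp: nontrivial_positions_def)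
  then have "card (nontrivial_positions (n + 1)) = (\<Sum>i\<in>{1..n + 1}. n + 1 - i)" by simp
  also have "{1..n + 1} = insert 1 {2..n + 1}" by auto
  finally show ?thesis using p by simp
qed

lemma card_elbows:
  assumes "D \<subseteq> nontrivial_positions (n + 1)"
  shows "card (elbows n D) + card D = card (strand_pairs n) + n"
  using assms card_nontrivial_positions[of n] finite_nontrivial_positions[of "n + 1"]
    card_mono[OF finite_nontrivial_positions assms]
  by (simp add: elbows_def card_Diff_subset finite_subset)

lemma finite_elbows: "finite (elbows n D)"
  using finite_nontrivial_positions by (simp add: elbows_def)

text \<open>At most one strand enters a cell through each of its two entry edges.\<close>

lemma crossings_disjoint:
  assumes "z \<in> crossings D k l" "z \<in> crossings D k' l'" "k < l" "k' < l'"
  shows "k = k' \<and> l = l'"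
proof -
  obtain i j where z: "z = (i, j)" by (cases z)
  have u: "s = t" if "strand D s i j e" "strand D t i j e" for s t e
    using strand_unique that by blast
  obtain e1 e2 where 1: "strand D k i j e1" "strand D l i j e2"
    using assms(1) z by (auto simp: crossings_def)
  obtain f1 f2 where 2: "strand D k' i j f1" "strand D l' i j f2"
    using assms(2) z by (auto simp: crossings_def)
  have "e1 \<noteq> e2" "f1 \<noteq> f2" using 1 2 u assms(3,4) by blast+
  then consider "e1 = f1" "e2 = f2" | "e1 = f2" "e2 = f1"
    by (cases e1; cases e2; cases f1; cases f2) auto
  then show ?thesis
  proof cases
    case 1
    then show ?thesis using \<open>strand D k i j e1\<close> \<open>strand D l i j e2\<close> 2 u by blast
  next
    case 2
    then have "k = l'" "l = k'" using \<open>strand D k i j e1\<close> \<open>strand D l i j e2\<close>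
        \<open>strand D k' i j f1\<close> \<open>strand D l' i j f2\<close> u by blast+
    then show ?thesis using assms(3,4) by simp
  qed
qed

lemma sum_card_crossings_le:
  assumes "finite D"
  shows "(\<Sum>(k, l)\<in>strand_pairs n. card (crossings D k l)) \<le> card D"
proof -
  have fin: "finite (crossings D k l)" for k l
    using assms by (rule rev_finite_subset) (auto simp: crossings_def)
  have "card (\<Union>p\<in>strand_pairs n. crossings D (fst p) (snd p)) =
      (\<Sum>p\<in>strand_pairs n. card (crossings D (fst p) (snd p)))"
  proof (rule card_UN_disjoint)
    show "\<forall>p\<in>strand_pairs n. \<forall>q\<in>strand_pairs n. p \<noteq> q \<longrightarrow>
        crossings D (fst p) (snd p) \<inter> crossings D (fst q) (snd q) = {}"
    proof (intro ballI impI equals0I)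
      fix p q z
      assume "p \<in> strand_pairs n" "q \<in> strand_pairs n" "p \<noteq> q"
        and "z \<in> crossings D (fst p) (snd p) \<inter> crossings D (fst q) (snd q)"
      then show False using crossings_disjoint[of z D "fst p" "snd p" "fst q" "snd q"]
        by (auto simp: strand_pairs_def prod_eq_iff)
    qed
  qed (use fin finite_strand_pairs in auto)
  moreover have "\<dots> \<le> card D \<longleftrightarrow> ?thesis" by (simp add: case_prod_beta)
  moreover have "card (\<Union>p\<in>strand_pairs n. crossings D (fst p) (snd p)) \<le> card D"
    using assms by (intro card_mono) (auto simp: crossings_def)
  ultimately show ?thesis by simp
qed

text \<open>The rc-graph condition without the bound on crossings; \<open>has_exits_iff_RC\<close>
  recovers the bound by counting.\<close>

definition has_exits :: "nat \<Rightarrow> (nat \<times> nat) set \<Rightarrow> bool" where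
  "has_exits n D \<longleftrightarrow> D \<subseteq> nontrivial_positions (n + 1) \<and> (\<forall>k\<in>{1..n + 1}. exits_at D k (w_perm n k))"

lemma has_exits_finite: "has_exits n D \<Longrightarrow> finite D"
  using finite_nontrivial_positions finite_subset unfolding has_exits_def by blast

lemma has_exits_exits_at: "has_exits n D \<Longrightarrow> k \<in> {1..n + 1} \<Longrightarrow> exits_at D k (w_perm n k)"
  by (simp only: has_exits_def)

text \<open>\<open>strand_pairs n\<close> consists of the inversions of \<open>w_perm n\<close>, and
  strands that exit in reversed order have to cross.\<close>

lemma has_exits_crossings:
  assumes "has_exits n D" "(k, l) \<in> strand_pairs n"
  shows "1 \<le> card (crossings D k l)"
proof -
  have "finite (crossings D k l)"
    using has_exits_finite[OF assms(1)] by (rule rev_finite_subset) (auto simp: crossings_def)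
  moreover have "crossings D k l \<noteq> {}"
  proof (rule reversed_strands_cross)
    show "D \<subseteq> nontrivial_positions (n + 1)" using assms(1) by (simp add: has_exits_def)
    show "exits_at D k (w_perm n k)" "exits_at D l (w_perm n l)"
      using assms has_exits_exits_at by (auto simp: strand_pairs_def)
  qed (use assms(2) in \<open>auto simp: strand_pairs_def w_perm_def\<close>)
  ultimately show ?thesis by (simp add: Suc_le_eq card_gt_0_iff)
qed

lemma has_exits_card_elbows_le:
  assumes "has_exits n D"
  shows "card (elbows n D) \<le> n"
proof -
  have "card (strand_pairs n) = (\<Sum>(k, l)\<in>strand_pairs n. 1)" by (simp add: case_prod_beta)
  also have "\<dots> \<le> (\<Sum>(k, l)\<in>strand_pairs n. card (crossings D k l))"
    using has_exits_crossings[OF assms] by (intro sum_mono) auto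
  also have "\<dots> \<le> card D" by (rule sum_card_crossings_le[OF has_exits_finite[OF assms]])
  finally show ?thesis using card_elbows[of D n] assms by (simp add: has_exits_def)
qed

text \<open>With a cross in the corner, the exit at column 1 would be fed from below, but strand 1
  starts in row 1 and never comes from below that row.\<close>

lemma has_exits_corner:
  assumes "has_exits n D"
  shows "(1, 1) \<notin> D"
proof
  assume c: "(1, 1) \<in> D"
  have "strand D 1 0 1 Bottom_Edge"
    using has_exits_exits_at[OF assms, of 1] by (simp add: exits_at_def w_perm_def)
  then show False
    by cases (use c strand_bounds in \<open>fastforce+\<close>)
qed

definition turns :: "(nat \<times> nat) set \<Rightarrow> nat \<Rightarrow> ((nat \<times> nat) \<times> edge) set" where
  "turns D k = {((i, j), e). 1 \<le> i \<and> (i, j) \<notin> D \<and> strand D k i j e}"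

text \<open>Entry edges available to the strands 2, ..., n+1: two at each nontrivial elbow and one
  at each of the \<open>n + 1\<close> anti-diagonal elbows, less the left edge of the corner, where
  strand 1 starts.\<close>

lemma turns_bound:
  assumes "has_exits n D"
  shows "finite (\<Union>k\<in>{2..n + 1}. turns D k)"
    and "card (\<Union>k\<in>{2..n + 1}. turns D k) \<le> 2 * card (elbows n D) + n"
proof -
  let ?A = "elbows n D \<times> {Left_Edge, Bottom_Edge} - {((1, 1), Left_Edge)}"
  let ?B = "(\<lambda>i. ((i, n + 2 - i), Left_Edge)) ` {1..n + 1}"
  have sub: "(\<Union>k\<in>{2..n + 1}. turns D k) \<subseteq> ?A \<union> ?B"
  proof
    fix z assume "z \<in> (\<Union>k\<in>{2..n + 1}. turns D k)"
    then obtain i j e k where z: "z = ((i, j), e)" "2 \<le> k" "k \<le> n + 1" "1 \<le> i" "(i, j) \<notin> D"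
        "strand D k i j e" by (auto simp: turns_def)
    have b: "1 \<le> j" "i + j \<le> n + 2" "e = Bottom_Edge \<Longrightarrow> i + j \<le> n + 1"
      using strand_bounds[OF z(6)] strand_antidiagonal[OF z(6), of "n + 1"] z(3) assms
      by (auto simp: has_exits_def)
    have ne: "\<not> (i = 1 \<and> j = 1 \<and> e = Left_Edge)"
      using strand_unique[OF z(6), of 1] strand.start[of D 1] z(2) by auto
    show "z \<in> ?A \<union> ?B"
    proof (cases "i + j \<le> n + 1")
      case True
      then have "z \<in> ?A" using z b ne by (cases e) (auto simp: elbows_def nontrivial_positions_def)
      then show ?thesis by blast
    next
      case False
      then have "e = Left_Edge" "j = n + 2 - i" "i \<in> {1..n + 1}" using b z by (cases e; auto)+
      then show ?thesis using z by blast
    qed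
  qed
  have fin: "finite (?A \<union> ?B)" using finite_elbows by auto
  show "finite (\<Union>k\<in>{2..n + 1}. turns D k)" using sub fin by (rule finite_subset)
  show "card (\<Union>k\<in>{2..n + 1}. turns D k) \<le> 2 * card (elbows n D) + n"
  proof (cases "n = 0")
    case True
    then show ?thesis by simp
  next
    case False
    then have "(1, 1) \<in> elbows n D"
      using has_exits_corner[OF assms] by (simp add: elbows_def nontrivial_positions_def)
    then have A: "card ?A = 2 * card (elbows n D) - 1" "1 \<le> card (elbows n D)"
      using finite_elbows[of n D] by (auto simp: card_cartesian_product Suc_le_eq card_gt_0_iff)
    have "card ?B \<le> n + 1" using card_image_le[of "{1..n + 1}"] by fastforce
    then show ?thesis using card_mono[OF fin sub] card_Un_le[of ?A ?B] A by linarith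
  qed
qed

text \<open>Going straight up from its first turn, the strand would leave in column \<open>j\<close>
  with \<open>k + j \<le> n + 2\<close>, short of its exit \<open>n + 3 - k\<close>. So it turns
  right again, and a horizontal run always ends at an elbow.\<close>

lemma first_turns:
  assumes D: "has_exits n D" and k: "2 \<le> k" "k \<le> n + 1"
  obtains i j j' where "1 \<le> i" "i < k" "1 \<le> j" "j < j'" "k + j \<le> n + 2"
    "(k, j) \<notin> D" "\<And>y. 1 \<le> y \<Longrightarrow> y < j \<Longrightarrow> (k, y) \<in> D"
    "(i, j) \<notin> D" "\<And>x. i < x \<Longrightarrow> x < k \<Longrightarrow> (x, j) \<in> D"
    "(i, j') \<notin> D" "\<And>y. j < y \<Longrightarrow> y < j' \<Longrightarrow> (i, y) \<in> D"
    "strand D k k j Left_Edge" "strand D k i j Bottom_Edge" "strand D k i j' Left_Edge"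
proof -
  have sub: "D \<subseteq> nontrivial_positions (n + 1)" and ex: "exits_at D k (n + 3 - k)"
    using D has_exits_exits_at[OF D, of k] k by (simp_all add: has_exits_def w_perm_def)
  have fin: "finite D" using has_exits_finite[OF D] .
  obtain j where j: "1 \<le> j" "(k, j) \<notin> D" "\<And>y. 1 \<le> y \<Longrightarrow> y < j \<Longrightarrow> (k, y) \<in> D"
      "strand D k k j Left_Edge"
    by (rule horizontal_run[OF strand.start[of D k] fin]) (use k in auto)
  have kj: "k + j \<le> n + 2" using strand_antidiagonal[OF j(4) sub] k by simp
  have up: "strand D k (k - 1) j Bottom_Edge" using elbow_up[OF j(4,2)] k by simp
  show ?thesis
  proof (rule vertical_run[OF up])
    fix i assume i: "1 \<le> i" "i \<le> k - 1" "(i, j) \<notin> D" "\<And>x. i < x \<Longrightarrow> x \<le> k - 1 \<Longrightarrow> (x, j) \<in> D"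
      "strand D k i j Bottom_Edge"
    obtain j' where j': "Suc j \<le> j'" "(i, j') \<notin> D" "\<And>y. Suc j \<le> y \<Longrightarrow> y < j' \<Longrightarrow> (i, y) \<in> D"
        "strand D k i j' Left_Edge"
      by (rule horizontal_run[OF elbow_right[OF i(5,3,1)] fin i(1)]) simp
    show ?thesis by (rule that[of i j j']) (use i j kj j' k in auto)
  next
    assume "strand D k 0 j Bottom_Edge"
    then have "j = n + 3 - k" using exits_at_unique[OF sub _ ex, of j] k by (simp add: exits_at_def)
    then show ?thesis using kj k by simp
  qed
qed

lemma turns_disjoint: "k \<noteq> l \<Longrightarrow> turns D k \<inter> turns D l = {}"
  using strand_unique by (auto simp: turns_def)

text \<open>Three turns for each of \<open>n\<close> strands give
  \<open>3 * n \<le> 2 * e + n\<close> for the number \<open>e\<close> of elbows, while the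
  crossings give \<open>e \<le> n\<close>. Hence all these inequalities are equalities.\<close>

lemma has_exits_turns:
  assumes D: "has_exits n D"
  shows "card (elbows n D) = n" and "\<And>k. k \<in> {2..n + 1} \<Longrightarrow> card (turns D k) = 3"
proof -
  have fin: "finite (turns D k)" if "k \<in> {2..n + 1}" for k
    by (rule finite_subset[OF _ turns_bound(1)[OF D]]) (use that in auto)
  have three: "3 \<le> card (turns D k)" if k: "k \<in> {2..n + 1}" for k
  proof -
    obtain i j j' where t: "1 \<le> i" "i < k" "j < j'" "(k, j) \<notin> D" "(i, j) \<notin> D" "(i, j') \<notin> D"
      "strand D k k j Left_Edge" "strand D k i j Bottom_Edge" "strand D k i j' Left_Edge"
      by (rule first_turns[OF D, of k]) (use k in auto)
    let ?S = "{((k, j), Left_Edge), ((i, j), Bottom_Edge), ((i, j'), Left_Edge)}"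
    have "?S \<subseteq> turns D k" using t by (auto simp: turns_def)
    then have "card ?S \<le> card (turns D k)" by (rule card_mono[OF fin[OF k]])
    then show ?thesis using t by simp
  qed
  have "(\<Sum>k\<in>{2..n + 1}. card (turns D k)) = card (\<Union>k\<in>{2..n + 1}. turns D k)"
    using fin turns_disjoint by (intro card_UN_disjoint[symmetric]) auto
  also have "\<dots> \<le> 2 * card (elbows n D) + n" by (rule turns_bound(2)[OF D])
  finally have up: "(\<Sum>k\<in>{2..n + 1}. card (turns D k)) \<le> 2 * card (elbows n D) + n" .
  have low: "3 * n \<le> (\<Sum>k\<in>{2..n + 1}. card (turns D k))"
    using sum_mono[of "{2..n + 1}" "\<lambda>_. 3" "\<lambda>k. card (turns D k)"] three by simp
  show e: "card (elbows n D) = n"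
    using has_exits_card_elbows_le[OF D] up low by simp
  show "card (turns D k) = 3" if k: "k \<in> {2..n + 1}" for k
  proof (rule ccontr)
    assume "card (turns D k) \<noteq> 3"
    then have "3 < card (turns D k)" using three[OF k] by simp
    then have "(\<Sum>k\<in>{2..n + 1}. 3) < (\<Sum>k\<in>{2..n + 1}. card (turns D k))"
      using three k by (intro sum_strict_mono_ex1) auto
    then show False using up e by simp
  qed
qed

text \<open>With exactly \<open>n\<close> elbows there are as many crosses as pairs of strands that
  must cross, so no pair can cross twice.\<close>

lemma has_exits_iff_RC: "D \<in> RC n \<longleftrightarrow> has_exits n D"
proof
  assume "D \<in> RC n"
  then show "has_exits n D" by (simp add: rc_graphs_def has_exits_def)
next
  assume D: "has_exits n D"
  then have fin: "finite D" by (rule has_exits_finite)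
  have cD: "card D = card (strand_pairs n)"
    using card_elbows[of D n] has_exits_turns(1)[OF D] D by (simp add: has_exits_def)
  have one: "card (crossings D k l) \<le> 1" if kl: "(k, l) \<in> strand_pairs n" for k l
  proof (rule ccontr)
    assume "\<not> ?thesis"
    then have "(\<Sum>(k, l)\<in>strand_pairs n. 1) < (\<Sum>(k, l)\<in>strand_pairs n. card (crossings D k l))"
      using has_exits_crossings[OF D] kl finite_strand_pairs
      by (intro sum_strict_mono_ex1) (auto intro!: bexI[of _ "(k, l)"])
    then show False using sum_card_crossings_le[OF fin, of n] cD by (simp add: case_prod_beta)
  qed
  \<comment> \<open>Strand 1 turns up at the corner elbow and leaves, so it meets no cross.\<close>
  have first: "crossings D 1 l = {}" for l
  proof -
    have "i = 1 \<and> j = 1 \<and> e = Left_Edge \<or> i = 0 \<and> j = 1" if "strand D 1 i j e" for i j e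
      using that by induction (use has_exits_corner[OF D] in auto)
    moreover have "(0, 1) \<notin> D" using D by (auto simp: has_exits_def nontrivial_positions_def)
    ultimately show ?thesis using has_exits_corner[OF D] by (auto simp: crossings_def)
  qed
  have "card (crossings D k l) \<le> 1" if "k \<in> {1..n + 1}" "l \<in> {1..n + 1}" "k \<noteq> l" for k l
  proof -
    have "k = 1 \<or> l = 1 \<or> (k, l) \<in> strand_pairs n \<or> (l, k) \<in> strand_pairs n"
      using that by (auto simp: strand_pairs_def)
    then consider "k = 1" | "l = 1" | "(k, l) \<in> strand_pairs n" | "(l, k) \<in> strand_pairs n"
      by blast
    then show ?thesis
      using one[of k l] one[of l k] first[of k] first[of l] crossings_commute[of D k l] by cases auto
  qed
  then show "D \<in> RC n" using D by (simp add: rc_graphs_def has_exits_def)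
qed

section \<open>Triangulations\<close>

text \<open>The cell \<open>(i, j)\<close> stands for the segment between the vertices \<open>i - 1 < n + 2 - j\<close> of a polygon
  with the vertices \<open>0, \<dots>, n + 1\<close>.\<close>

definition segment :: "nat \<Rightarrow> (nat \<times> nat) set \<Rightarrow> nat \<Rightarrow> nat \<Rightarrow> bool" where
  "segment n D a b \<longleftrightarrow> a < b \<and> b \<le> n + 1 \<and> (Suc a, n + 2 - b) \<notin> D"

text \<open>The itinerary of strand \<open>b + 1\<close>: its turns are the segments from
  \<open>b\<close> to \<open>c\<close>, from \<open>a\<close> to \<open>c\<close> and from
  \<open>a\<close> to \<open>b\<close>, in this order. The clauses on absent segments say that the
  straight runs before, between and after these turns consist of crosses.\<close>

definition triangle :: "(nat \<Rightarrow> nat \<Rightarrow> bool) \<Rightarrow> nat \<Rightarrow> nat \<Rightarrow> nat \<Rightarrow> bool" where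
  "triangle E a b c \<longleftrightarrow> a < b \<and> b < c \<and> E b c \<and> (\<forall>y. E b y \<longrightarrow> y \<le> c) \<and>
    E a c \<and> (\<forall>x. a < x \<longrightarrow> x < b \<longrightarrow> \<not> E x c) \<and>
    E a b \<and> (\<forall>y. b < y \<longrightarrow> y < c \<longrightarrow> \<not> E a y) \<and> (\<forall>x<a. \<not> E x b)"

text \<open>Instead of forbidding crossing segments, this asks for a triangle with each given middle
  vertex, which is the form in which the strands supply it.\<close>

definition triangulation :: "nat \<Rightarrow> (nat \<Rightarrow> nat \<Rightarrow> bool) \<Rightarrow> bool" where
  "triangulation n E \<longleftrightarrow> (\<forall>a b. E a b \<longrightarrow> a < b \<and> b \<le> n + 1) \<and> (\<forall>a\<le>n. E a (Suc a)) \<and> E 0 (n + 1) \<and>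
    (\<forall>b\<in>{1..n}. \<exists>a c. triangle E a b c)"

lemma has_exits_triangle:
  assumes D: "has_exits n D" and b: "b \<in> {1..n}"
  shows "\<exists>a c. triangle (segment n D) a b c"
proof -
  let ?k = "Suc b"
  have k: "2 \<le> ?k" "?k \<le> n + 1" and k': "?k \<in> {2..n + 1}" using b by auto
  have sub: "D \<subseteq> nontrivial_positions (n + 1)" and ex: "exits_at D ?k (n + 2 - b)"
    using D has_exits_exits_at[OF D, of ?k] b by (simp_all add: has_exits_def w_perm_def)
  obtain i j j' where t: "1 \<le> i" "i < ?k" "1 \<le> j" "j < j'" "?k + j \<le> n + 2"
    "(?k, j) \<notin> D" "\<forall>y. 1 \<le> y \<longrightarrow> y < j \<longrightarrow> (?k, y) \<in> D"
    "(i, j) \<notin> D" "\<forall>x. i < x \<longrightarrow> x < ?k \<longrightarrow> (x, j) \<in> D"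
    "(i, j') \<notin> D" "\<forall>y. j < y \<longrightarrow> y < j' \<longrightarrow> (i, y) \<in> D"
    "strand D ?k ?k j Left_Edge" "strand D ?k i j Bottom_Edge" "strand D ?k i j' Left_Edge"
    by (rule first_turns[OF D k]) blast
  have up: "strand D ?k (i - 1) j' Bottom_Edge" using elbow_up[OF t(14,10,1)] .
  have last: "j' = n + 2 - b \<and> (\<forall>x. 1 \<le> x \<longrightarrow> x < i \<longrightarrow> (x, j') \<in> D)"
  proof (rule vertical_run[OF up])
    fix x assume x: "1 \<le> x" "x \<le> i - 1" "(x, j') \<notin> D" "strand D ?k x j' Bottom_Edge"
    \<comment> \<open>An elbow above the third turn would be a fourth one, so the strand runs
      straight to the top and the third turn lies in its exit column.\<close>
    let ?S = "{((?k, j), Left_Edge), ((i, j), Bottom_Edge), ((i, j'), Left_Edge), ((x, j'), Bottom_Edge)}"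
    have "?S \<subseteq> turns D ?k" using t x by (auto simp: turns_def)
    moreover have "finite (turns D ?k)" using has_exits_turns(2)[OF D k'] k card.infinite by fastforce
    ultimately have "card ?S \<le> 3" using has_exits_turns(2)[OF D k'] k card_mono by fastforce
    then show ?thesis using t x by simp
  next
    assume *: "\<And>x. 1 \<le> x \<Longrightarrow> x \<le> i - 1 \<Longrightarrow> (x, j') \<in> D" "strand D ?k 0 j' Bottom_Edge"
    then have "j' = n + 2 - b" using exits_at_unique[OF sub _ ex, of j'] k by (simp add: exits_at_def)
    then show ?thesis using * by auto
  qed
  obtain a where a: "i = Suc a" using t(1) by (cases i) auto
  define c where "c = n + 2 - j"
  have c: "j = n + 2 - c" "c \<le> n + 1" using t(3,5) by (auto simp: c_def)
  have "triangle (segment n D) a b c"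
    unfolding triangle_def
  proof (intro conjI allI impI)
    fix y assume "segment n D b y"
    then show "y \<le> c" using t(7)[rule_format, of "n + 2 - y"] c by (force simp: segment_def)
  next
    fix x assume "a < x" "x < b"
    then show "\<not> segment n D x c" using t(9) a c by (auto simp: segment_def)
  next
    fix y assume "b < y" "y < c"
    then show "\<not> segment n D a y" using t(11)[rule_format, of "n + 2 - y"] a c last b by (auto simp: segment_def)
  next
    fix x assume "x < a"
    then show "\<not> segment n D x b" using last a by (auto simp: segment_def)
  qed (use t a c last b in \<open>auto simp: segment_def\<close>)
  then show ?thesis by blast
qed

lemma segment_trivial:
  assumes "D \<subseteq> nontrivial_positions (n + 1)" "a \<le> n"
  shows "segment n D a (Suc a)"
  using assms by (auto simp: segment_def nontrivial_positions_def)

text \<open>For the converse, strand \<open>b + 1\<close> is driven along its triangle: right to the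
  segment from \<open>b\<close> to \<open>c\<close>, up to the one from \<open>a\<close> to
  \<open>c\<close>, right to the one from \<open>a\<close> to \<open>b\<close>, and up to the exit
  in column \<open>n + 2 - b\<close>.\<close>

lemma has_exits_iff_triangulation:
  assumes sub: "D \<subseteq> nontrivial_positions (n + 1)"
  shows "has_exits n D \<longleftrightarrow> triangulation n (segment n D)"
proof
  assume D: "has_exits n D"
  have "segment n D 0 (n + 1)" using has_exits_corner[OF D] by (simp add: segment_def)
  then show "triangulation n (segment n D)"
    using has_exits_triangle[OF D] segment_trivial[OF sub] unfolding triangulation_def
    by (auto simp: segment_def)
next
  assume T: "triangulation n (segment n D)"
  have "exits_at D k (w_perm n k)" if k: "k \<in> {1..n + 1}" for k
  proof (cases "k = 1")
    case True
    have "(1, 1) \<notin> D" using T by (auto simp: triangulation_def segment_def)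
    then have "strand D 1 0 1 Bottom_Edge"
      using elbow_up[OF strand.start[of D 1]] by simp
    then show ?thesis using True by (simp add: exits_at_def w_perm_def)
  next
    case False
    define b where "b = k - 1"
    have kb: "k = Suc b" and b: "b \<in> {1..n}" using False k by (auto simp: b_def)
    obtain a c where "triangle (segment n D) a b c" using T b unfolding triangulation_def by blast
    then have abc: "a < b" "b < c" "segment n D b c" "\<forall>y. segment n D b y \<longrightarrow> y \<le> c"
      "segment n D a c" "\<forall>x. a < x \<longrightarrow> x < b \<longrightarrow> \<not> segment n D x c" "segment n D a b"
      "\<forall>y. b < y \<longrightarrow> y < c \<longrightarrow> \<not> segment n D a y" "\<forall>x. x < a \<longrightarrow> \<not> segment n D x b"
      unfolding triangle_def by blast+
    have c: "c \<le> n + 1" using abc(3) by (simp add: segment_def)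
    let ?j = "n + 2 - c" and ?j' = "n + 2 - b"
    have s1: "strand D k k ?j Left_Edge"
    proof (rule strand_horizontal[OF strand.start])
      fix y assume y: "1 \<le> y" "y < ?j"
      then have "\<not> segment n D b (n + 2 - y)" using abc(4)[rule_format, of "n + 2 - y"] c by linarith
      then show "(k, y) \<in> D" using y kb b c abc(2) by (auto simp: segment_def)
    qed (use c kb in auto)
    have "strand D k b ?j Bottom_Edge"
      using elbow_up[OF s1] abc(3) kb by (simp add: segment_def)
    then have s2: "strand D k (Suc a) ?j Bottom_Edge"
    proof (rule strand_vertical)
      fix x assume x: "Suc a < x" "x \<le> b"
      then show "(x, ?j) \<in> D" using abc(6)[rule_format, of "x - 1"] abc(2) c by (auto simp: segment_def)
    qed (use abc in auto)
    have "strand D k (Suc a) (Suc ?j) Left_Edge"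
      using elbow_right[OF s2] abc(5) by (simp add: segment_def)
    then have s3: "strand D k (Suc a) ?j' Left_Edge"
    proof (rule strand_horizontal)
      fix y assume y: "Suc ?j \<le> y" "y < ?j'"
      then show "(Suc a, y) \<in> D" using abc(8)[rule_format, of "n + 2 - y"] abc(1) c by (auto simp: segment_def)
    qed (use abc c in auto)
    have "strand D k a ?j' Bottom_Edge"
      using elbow_up[OF s3] abc(7) by (simp add: segment_def)
    then have "strand D k 0 ?j' Bottom_Edge"
    proof (rule strand_vertical)
      fix x assume x: "0 < x" "x \<le> a"
      then show "(x, ?j') \<in> D" using abc(9)[rule_format, of "x - 1"] abc(1) b by (auto simp: segment_def)
    qed auto
    then show ?thesis using kb b by (simp add: exits_at_def w_perm_def)
  qed
  then show "has_exits n D" using sub by (simp add: has_exits_def)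
qed

section \<open>The boundary chain, and uniqueness of a triangulation with given degrees\<close>

lemma triangulationD:
  assumes "triangulation n E"
  shows "E a b \<Longrightarrow> a < b" "E a b \<Longrightarrow> b \<le> n + 1" "a \<le> n \<Longrightarrow> E a (Suc a)" "E 0 (n + 1)"
  using assms unfolding triangulation_def by blast+

lemma finite_neighbours:
  assumes "triangulation n E"
  shows "finite {b. E a b}"
  by (rule finite_subset[of _ "{..n + 1}"]) (use triangulationD(2)[OF assms] in auto)

text \<open>The vertices of the outer boundary chain from \<open>r\<close> to \<open>n + 1\<close> of the part of the triangulation
  whose segments start at \<open>r\<close> or later: the triangle with the middle vertex \<open>b\<close> has its smallest vertex
  below \<open>r\<close>.\<close>

definition chain :: "nat \<Rightarrow> (nat \<Rightarrow> nat \<Rightarrow> bool) \<Rightarrow> nat \<Rightarrow> nat set" where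
  "chain n E r = {b. r \<le> b \<and> b \<le> n + 1 \<and>
    \<not> (\<exists>x c. r \<le> x \<and> x < b \<and> E x c \<and> E b c \<and> (\<forall>y. E b y \<longrightarrow> y \<le> c))}"

text \<open>The successor of a vertex in the chain is its largest neighbour.\<close>

definition chain_linked :: "nat \<Rightarrow> (nat \<Rightarrow> nat \<Rightarrow> bool) \<Rightarrow> nat \<Rightarrow> bool" where
  "chain_linked n E r \<longleftrightarrow> (\<forall>b\<in>chain n E r. b \<le> n \<longrightarrow> (\<exists>c\<in>chain n E r. b < c \<and> E b c \<and>
    (\<forall>y. E b y \<longrightarrow> y \<le> c) \<and> (\<forall>z\<in>chain n E r. z \<le> b \<or> c \<le> z)))"

lemma triangulation_triangle:
  assumes "triangulation n E" "1 \<le> b" "b \<le> n"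
  shows "\<exists>a c. triangle E a b c"
  using assms unfolding triangulation_def by (metis atLeastAtMost_iff)

text \<open>The smallest vertex of the triangle with the middle vertex \<open>b\<close> is the
  smallest neighbour of \<open>b\<close>, hence at most \<open>a\<close>. If \<open>b\<close> were
  missing from the chain, that vertex would have to exceed \<open>a\<close>.\<close>

lemma neighbour_in_chain:
  assumes T: "triangulation n E" and "E a b"
  shows "b \<in> chain n E (Suc a)"
proof (rule ccontr)
  assume n: "b \<notin> chain n E (Suc a)"
  have b: "a < b" "b \<le> n + 1" using triangulationD(1,2)[OF T assms(2)] by blast+
  then obtain x c where x: "Suc a \<le> x" "x < b" "E x c" "E b c" "\<forall>y. E b y \<longrightarrow> y \<le> c"
    using n by (auto simp: chain_def)
  have "b \<le> n" using triangulationD(1,2)[OF T x(4)] by simp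
  then obtain a' c' where t: "triangle E a' b c'" using triangulation_triangle[OF T, of b] b(1) by auto
  have "c = c'" using t x unfolding triangle_def by (simp add: order_antisym)
  then have "\<not> a' < x" using t x unfolding triangle_def by blast
  then show False using t x(1) assms(2) unfolding triangle_def by auto
qed

text \<open>Descends along the chain from \<open>v\<close>. If the successor \<open>c\<close> of
  \<open>u\<close> is joined to \<open>a\<close>, then the triangle with the middle vertex
  \<open>u\<close> has the largest vertex \<open>c\<close>; its smallest vertex is at least
  \<open>a\<close>, as \<open>a\<close> sees \<open>c\<close>, and at most \<open>a\<close>, as
  \<open>u\<close> is in the chain. So \<open>a\<close> is joined to \<open>u\<close>.\<close>

lemma neighbours_initial:
  assumes T: "triangulation n E" and L: "chain_linked n E (Suc a)"
  shows "E a v \<Longrightarrow> u \<in> chain n E (Suc a) \<Longrightarrow> u < v \<Longrightarrow> E a u"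
proof (induction "v - u" arbitrary: u rule: less_induct)
  case less
  have v: "v \<in> chain n E (Suc a)" using neighbour_in_chain[OF T less.prems(1)] .
  have u: "u \<le> n" "a < u" using triangulationD(1,2)[OF T less.prems(1)] less.prems by (auto simp: chain_def)
  obtain c where c: "c \<in> chain n E (Suc a)" "u < c" "E u c" "\<forall>y. E u y \<longrightarrow> y \<le> c"
    "\<forall>z\<in>chain n E (Suc a). z \<le> u \<or> c \<le> z"
    using L less.prems(2) u unfolding chain_linked_def by blast
  have "c \<le> v" using c(5) v less.prems(3) by force
  then have ac: "E a c" using less.hyps[of c] c less.prems by (cases "c = v") auto
  obtain a' c' where t: "triangle E a' u c'" using triangulation_triangle[OF T, of u] u by auto
  have cc: "c = c'" using t c unfolding triangle_def by (simp add: order_antisym)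
  then have "a \<le> a'" using t ac u unfolding triangle_def by (meson not_less)
  moreover have "\<not> Suc a \<le> a'"
    using less.prems(2) t cc c(3,4) unfolding chain_def triangle_def by blast
  ultimately have "a = a'" by simp
  then show ?case using t by (simp add: triangle_def)
qed

text \<open>The new vertex \<open>a\<close> is joined to the old chain up to its largest neighbour
  \<open>m\<close>; the chain vertices before \<open>m\<close> become middle vertices of triangles
  at \<open>a\<close> and drop out.\<close>

lemma chain_step:
  assumes T: "triangulation n E" and L: "chain_linked n E (Suc a)" and a: "a \<le> n"
  defines "m \<equiv> Max {b. E a b}"
  shows "E a m" "\<And>y. E a y \<Longrightarrow> y \<le> m" "chain n E a = insert a {b \<in> chain n E (Suc a). m \<le> b}"
proof -
  show m: "E a m"
    using Max_in[OF finite_neighbours[OF T], of a] triangulationD(3)[OF T a] unfolding m_def by auto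
  show max: "y \<le> m" if "E a y" for y
    using Max_ge[OF finite_neighbours[OF T], of y a] that unfolding m_def by simp
  show "chain n E a = insert a {b \<in> chain n E (Suc a). m \<le> b}"
  proof (intro equalityI subsetI)
    fix b assume b: "b \<in> chain n E a"
    show "b \<in> insert a {b \<in> chain n E (Suc a). m \<le> b}"
    proof (cases "b = a")
      case False
      then have bU: "b \<in> chain n E (Suc a)" using b unfolding chain_def by (auto dest: Suc_leD)
      have "m \<le> b"
      proof (rule ccontr)
        assume bm: "\<not> m \<le> b"
        then have "b \<le> n" using triangulationD(2)[OF T m] by simp
        then obtain c where c: "c \<in> chain n E (Suc a)" "b < c" "E b c" "\<forall>y. E b y \<longrightarrow> y \<le> c"
          "\<forall>z\<in>chain n E (Suc a). z \<le> b \<or> c \<le> z"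
          using L bU unfolding chain_linked_def by blast
        have "c \<le> m" using c(5) neighbour_in_chain[OF T m] bm by force
        then have "E a c" using neighbours_initial[OF T L m c(1)] m by (cases "c = m") auto
        moreover have "a < b" using b False by (simp add: chain_def)
        ultimately show False using b c(3,4) unfolding chain_def by blast
      qed
      then show ?thesis using bU by simp
    qed simp
  next
    fix b assume b: "b \<in> insert a {b \<in> chain n E (Suc a). m \<le> b}"
    show "b \<in> chain n E a"
    proof (cases "b = a")
      case True
      then show ?thesis using a by (auto simp: chain_def)
    next
      case False
      then have b: "b \<in> chain n E (Suc a)" "m \<le> b" using b by auto
      have False if "a \<le> x" "x < b" "E x c" "E b c" "\<forall>y. E b y \<longrightarrow> y \<le> c" for x c
      proof (cases "x = a")
        case True
        then have "c \<le> b" using max that b by (meson order_trans)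
        then show False using triangulationD(1)[OF T that(4)] by simp
      next
        case False
        then show False using b that unfolding chain_def by (simp; metis Suc_leI le_neq_implies_less)
      qed
      moreover have "a \<le> b" "b \<le> n + 1" using b(1) by (auto simp: chain_def)
      ultimately show ?thesis unfolding chain_def by blast
    qed
  qed
qed

text \<open>By downward induction, since \<open>chain_step\<close> for \<open>a\<close> presupposes
  a linked chain at \<open>Suc a\<close>.\<close>

lemma triangulation_chain_linked:
  assumes T: "triangulation n E" and "r \<le> n + 1"
  shows "chain_linked n E r"
  using assms(2)
proof (induction rule: inc_induct)
  case base
  show ?case by (auto simp: chain_linked_def chain_def)
next
  case (step a)
  let ?m = "Max {b. E a b}"
  have a: "a \<le> n" using step.hyps by simp
  note s = chain_step[OF T step.IH a]
  show ?case
    unfolding chain_linked_def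
  proof (intro ballI impI)
    fix b assume b: "b \<in> chain n E a" "b \<le> n"
    show "\<exists>c\<in>chain n E a. b < c \<and> E b c \<and> (\<forall>y. E b y \<longrightarrow> y \<le> c) \<and> (\<forall>z\<in>chain n E a. z \<le> b \<or> c \<le> z)"
    proof (cases "b = a")
      case True
      have "?m \<in> chain n E a" unfolding s(3) using neighbour_in_chain[OF T s(1)] by simp
      then show ?thesis using s triangulationD(1)[OF T s(1)] True by (intro bexI[of _ ?m]) auto
    next
      case False
      then have b': "b \<in> chain n E (Suc a)" "?m \<le> b" using b(1) unfolding s(3) by auto
      then obtain c where c: "c \<in> chain n E (Suc a)" "b < c" "E b c" "\<forall>y. E b y \<longrightarrow> y \<le> c"
          "\<forall>z\<in>chain n E (Suc a). z \<le> b \<or> c \<le> z"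
        using step.IH b(2) unfolding chain_linked_def by blast
      have "a \<le> b" using b(1) by (simp add: chain_def)
      then show ?thesis using c b' unfolding s(3) by (intro bexI[of _ c]) auto
    qed
  qed
qed

text \<open>Going down from the last vertex, both neighbour sets are initial parts of the same
  chain, hence comparable, and equal cardinality makes them equal.\<close>

lemma triangulation_eqI:
  assumes T: "triangulation n E" and T': "triangulation n E'"
    and c: "\<And>a. a \<le> n \<Longrightarrow> card {b. E a b} = card {b. E' a b}"
  shows "E = E'"
proof -
  have "\<forall>a\<ge>r. \<forall>b. E a b \<longleftrightarrow> E' a b" if "r \<le> n + 1" for r
    using that
  proof (induction rule: inc_induct)
    case base
    then show ?case using triangulationD(1,2)[OF T] triangulationD(1,2)[OF T'] by (metis leD order_trans)
  next
    case (step a)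
    have a: "a \<le> n" "Suc a \<le> n + 1" using step.hyps by simp_all
    have ch: "chain n E (Suc a) = chain n E' (Suc a)"
      using step.IH unfolding chain_def by (auto dest: less_imp_le_nat)
    let ?S = "{b. E a b}" and ?S' = "{b. E' a b}"
    have i: "E a u" if "E a v" "u \<in> chain n E (Suc a)" "u < v" for u v
      using neighbours_initial[OF T triangulation_chain_linked[OF T a(2)]] that by blast
    have i': "E' a u" if "E' a v" "u \<in> chain n E (Suc a)" "u < v" for u v
      using neighbours_initial[OF T' triangulation_chain_linked[OF T' a(2)]] that ch by blast
    have "?S \<subseteq> ?S' \<or> ?S' \<subseteq> ?S"
    proof (rule ccontr)
      assume "\<not> ?thesis"
      then obtain u v where "E a u" "\<not> E' a u" "E' a v" "\<not> E a v" by blast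
      moreover from this have "u \<in> chain n E (Suc a)" "v \<in> chain n E (Suc a)"
        using neighbour_in_chain[OF T] neighbour_in_chain[OF T'] ch by blast+
      ultimately show False using i[of u v] i'[of v u] by (metis linorder_neqE_nat)
    qed
    then have "?S = ?S'"
      using c[OF a(1)] card_subset_eq finite_neighbours[OF T] finite_neighbours[OF T'] by metis
    then show ?case using step.IH by (metis mem_Collect_eq Suc_leI le_neq_implies_less)
  qed
  then have "\<forall>a\<ge>0. \<forall>b. E a b \<longleftrightarrow> E' a b" by blast
  then show ?thesis by (intro ext) auto
qed

section \<open>Existence of a triangulation with prescribed degrees\<close>

lemma initial_segment_exists:
  fixes C :: "nat set"
  assumes "finite C" "k \<le> card C"
  shows "\<exists>S\<subseteq>C. card S = k \<and> (\<forall>x\<in>S. \<forall>y\<in>C. y < x \<longrightarrow> y \<in> S)"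
  using assms(2)
proof (induction k)
  case 0
  then show ?case by (intro exI[of _ "{}"]) auto
next
  case (Suc k)
  then obtain S where S: "S \<subseteq> C" "card S = k" "\<forall>x\<in>S. \<forall>y\<in>C. y < x \<longrightarrow> y \<in> S" by auto
  have "C - S \<noteq> {}" using S Suc.prems by auto
  then have m: "Min (C - S) \<in> C - S" "\<And>y. y \<in> C - S \<Longrightarrow> Min (C - S) \<le> y"
    using assms(1) Min_in[of "C - S"] by auto
  have "finite S" using S assms(1) finite_subset by blast
  then show ?case
    using S m by (intro exI[of _ "insert (Min (C - S)) S"]) (auto; force)
qed

text \<open>The part at the vertices from \<open>r\<close> on, with exposed chain \<open>C\<close>.
  \<open>d a\<close> counts the segments from \<open>a\<close> other than the side to
  \<open>Suc a\<close>. Adding \<open>a\<close> removes \<open>d a\<close> vertices from the chain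
  and adds one, which the cardinality clause records.\<close>

definition partial_triangulation ::
    "nat \<Rightarrow> (nat \<Rightarrow> nat) \<Rightarrow> nat \<Rightarrow> (nat \<Rightarrow> nat \<Rightarrow> bool) \<Rightarrow> nat set \<Rightarrow> bool" where
  "partial_triangulation n d r E C \<longleftrightarrow>
    (\<forall>a b. E a b \<longrightarrow> r \<le> a \<and> a < b \<and> b \<le> n + 1) \<and>
    (\<forall>a. r \<le> a \<longrightarrow> a \<le> n \<longrightarrow> E a (Suc a) \<and> card {b. E a b} = Suc (d a)) \<and>
    C \<subseteq> {r..n + 1} \<and> r \<in> C \<and> n + 1 \<in> C \<and> card C + (\<Sum>a\<in>{r..n}. d a) = n + 2 - r \<and>
    (\<forall>b\<in>C. b \<le> n \<longrightarrow> (\<exists>c\<in>C. b < c \<and> E b c \<and> (\<forall>y. E b y \<longrightarrow> y \<le> c) \<and>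
      (\<forall>z\<in>C. z \<le> b \<or> c \<le> z) \<and> (\<forall>x<b. \<not> E x c))) \<and>
    (\<forall>b\<in>{r..n} - C. \<exists>a c. triangle E a b c)"

lemma partial_triangulationD:
  assumes "partial_triangulation n d r E C"
  shows "\<forall>a b. E a b \<longrightarrow> r \<le> a \<and> a < b \<and> b \<le> n + 1"
    and "\<forall>a. r \<le> a \<longrightarrow> a \<le> n \<longrightarrow> E a (Suc a) \<and> card {b. E a b} = Suc (d a)"
    and "C \<subseteq> {r..n + 1}" "r \<in> C" "n + 1 \<in> C" "card C + (\<Sum>a\<in>{r..n}. d a) = n + 2 - r"
    and "\<forall>b\<in>C. b \<le> n \<longrightarrow> (\<exists>c\<in>C. b < c \<and> E b c \<and> (\<forall>y. E b y \<longrightarrow> y \<le> c) \<and>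
      (\<forall>z\<in>C. z \<le> b \<or> c \<le> z) \<and> (\<forall>x<b. \<not> E x c))"
    and "\<forall>b\<in>{r..n} - C. \<exists>a c. triangle E a b c"
proof -
  note P = assms[unfolded partial_triangulation_def]
  from P show "\<forall>a b. E a b \<longrightarrow> r \<le> a \<and> a < b \<and> b \<le> n + 1" by (elim conjE)
  from P show "\<forall>a. r \<le> a \<longrightarrow> a \<le> n \<longrightarrow> E a (Suc a) \<and> card {b. E a b} = Suc (d a)" by (elim conjE)
  from P show "C \<subseteq> {r..n + 1}" by (elim conjE)
  from P show "r \<in> C" by (elim conjE)
  from P show "n + 1 \<in> C" by (elim conjE)
  from P show "card C + (\<Sum>a\<in>{r..n}. d a) = n + 2 - r" by (elim conjE)
  from P show "\<forall>b\<in>C. b \<le> n \<longrightarrow> (\<exists>c\<in>C. b < c \<and> E b c \<and> (\<forall>y. E b y \<longrightarrow> y \<le> c) \<and>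
      (\<forall>z\<in>C. z \<le> b \<or> c \<le> z) \<and> (\<forall>x<b. \<not> E x c))" by (elim conjE)
  from P show "\<forall>b\<in>{r..n} - C. \<exists>a c. triangle E a b c" by (elim conjE)
qed

text \<open>Joins \<open>a\<close> to the first \<open>d a + 1\<close> vertices of the chain. The
  last of them, \<open>m\<close>, becomes the successor of \<open>a\<close>, and the ones before it
  leave the chain.\<close>

lemma partial_triangulation_step:
  assumes P: "partial_triangulation n d (Suc a) E C" and a: "a \<le> n"
    and d: "(\<Sum>a\<in>{a..n}. d a) \<le> n - a"
  shows "\<exists>E' C'. partial_triangulation n d a E' C'"
proof -
  have E: "Suc a \<le> x \<and> x < y \<and> y \<le> n + 1" if "E x y" for x y
    using partial_triangulationD(1)[OF P] that by blast
  have R: "E x (Suc x) \<and> card {b. E x b} = Suc (d x)" if "Suc a \<le> x" "x \<le> n" for x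
    using partial_triangulationD(2)[OF P] that by blast
  have C: "C \<subseteq> {Suc a..n + 1}" "Suc a \<in> C" "n + 1 \<in> C"
    "card C + (\<Sum>a\<in>{Suc a..n}. d a) = n + 1 - a"
    using partial_triangulationD(3-6)[OF P] by simp_all
  have N: "\<exists>c\<in>C. b < c \<and> E b c \<and> (\<forall>y. E b y \<longrightarrow> y \<le> c) \<and>
      (\<forall>z\<in>C. z \<le> b \<or> c \<le> z) \<and> (\<forall>x<b. \<not> E x c)" if "b \<in> C" "b \<le> n" for b
    using partial_triangulationD(7)[OF P] that by blast
  have Tr: "\<exists>a c. triangle E a b c" if "b \<in> {Suc a..n} - C" for b
    using partial_triangulationD(8)[OF P] that by blast
  have finC: "finite C" using C(1) finite_subset by blast
  have sum: "(\<Sum>a\<in>{a..n}. d a) = d a + (\<Sum>a\<in>{Suc a..n}. d a)"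
    using a by (rule sum.atLeast_Suc_atMost)
  \<comment> \<open>This is where the staircase bound enters: it says that the chain has enough
    vertices for the neighbours of \<open>a\<close>.\<close>
  have "Suc (d a) \<le> card C" using C(4) d sum a by linarith
  then obtain S where S: "S \<subseteq> C" "card S = Suc (d a)" "\<forall>x\<in>S. \<forall>y\<in>C. y < x \<longrightarrow> y \<in> S"
    using initial_segment_exists[OF finC] by blast
  have finS: "finite S" using S(1) finC finite_subset by blast
  define m where "m = Max S"
  have "S \<noteq> {}" using S(2) by auto
  then have m: "m \<in> S" "\<And>y. y \<in> S \<Longrightarrow> y \<le> m" using finS unfolding m_def by (auto intro: Max_in)
  have mC: "m \<in> C" using m(1) S(1) by blast
  define E' where "E' x y \<longleftrightarrow> E x y \<or> x = a \<and> y \<in> S" for x y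
  define C' where "C' = insert a {b \<in> C. m \<le> b}"
  have Suc_a: "Suc a \<in> S" using S(3) m(1) mC C(1,2) by (metis atLeastAtMost_iff le_neq_implies_less subsetD)
  have row: "E' x y \<longleftrightarrow> E x y" if "x \<noteq> a" for x y using that by (simp add: E'_def)
  have row_a: "E' a y \<longleftrightarrow> y \<in> S" for y using E[of a y] by (auto simp: E'_def)
  have low: "\<not> E' x y" if "x < a" for x y using E[of x y] that by (auto simp: E'_def)
  have "E' x y \<longrightarrow> a \<le> x \<and> x < y \<and> y \<le> n + 1" for x y
    using E[of x y] C(1) S(1) by (auto simp: E'_def)
  moreover have "E' x (Suc x) \<and> card {b. E' x b} = Suc (d x)" if "a \<le> x" "x \<le> n" for x
    using R[of x] that Suc_a S(2) by (cases "x = a") (auto simp: row row_a)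
  moreover have "C' \<subseteq> {a..n + 1}" "a \<in> C'" using C(1) a by (auto simp: C'_def)
  moreover have "n + 1 \<in> C'" using C(1,3) mC by (auto simp: C'_def)
  moreover have "card C' + (\<Sum>a\<in>{a..n}. d a) = n + 2 - a"
  proof -
    have "{b \<in> C. m \<le> b} = C - (S - {m})" using S(1,3) m mC by force
    then have "card {b \<in> C. m \<le> b} = card C - d a"
      using S(1,2) m(1) finS by (simp add: card_Diff_subset card_Diff_singleton subset_iff)
    moreover have "d a \<le> card C" using \<open>Suc (d a) \<le> card C\<close> by simp
    moreover have "a \<notin> C" using C(1) by auto
    ultimately show ?thesis using C(4) sum finC a unfolding C'_def by simp
  qed
  moreover have "\<exists>c\<in>C'. b < c \<and> E' b c \<and> (\<forall>y. E' b y \<longrightarrow> y \<le> c) \<and>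
      (\<forall>z\<in>C'. z \<le> b \<or> c \<le> z) \<and> (\<forall>x<b. \<not> E' x c)" if b: "b \<in> C'" "b \<le> n" for b
  proof (cases "b = a")
    case True
    have "a < m" using mC C(1) by auto
    then show ?thesis using True m mC low by (intro bexI[of _ m]) (auto simp: C'_def row_a)
  next
    case False
    then have b': "b \<in> C" "m \<le> b" using b by (auto simp: C'_def)
    obtain c where c: "c \<in> C" "b < c" "E b c" "\<forall>y. E b y \<longrightarrow> y \<le> c"
      "\<forall>z\<in>C. z \<le> b \<or> c \<le> z" "\<forall>x<b. \<not> E x c" using N[OF b'(1) b(2)] by blast
    have "\<not> E' x c" if "x < b" for x
      using c(2,6) that b'(2) m(2)[of c] by (auto simp: E'_def)
    moreover have "a < b" using b' C(1) by auto
    ultimately show ?thesis using c b' False by (intro bexI[of _ c]) (auto simp: C'_def row)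
  qed
  moreover have "\<exists>a c. triangle E' a b c" if b: "b \<in> {a..n} - C'" for b
  proof -
    have ab: "a < b" "b \<le> n" using b by (auto simp: C'_def)
    show ?thesis
    proof (cases "b \<in> C")
      case True
      then have bm: "b < m" using b by (auto simp: C'_def)
      then have bS: "b \<in> S" using S(3) m(1) True by blast
      obtain c where c: "c \<in> C" "b < c" "E b c" "\<forall>y. E b y \<longrightarrow> y \<le> c"
        "\<forall>z\<in>C. z \<le> b \<or> c \<le> z" "\<forall>x<b. \<not> E x c" using N[OF True ab(2)] by blast
      have "c \<le> m" using c(5) mC bm by force
      then have "c \<in> S" using S(3) m(1) c(1) by (cases "c = m") auto
      moreover have "\<forall>y\<in>S. y \<le> b \<or> c \<le> y" using c(5) S(1) by blast
      \<comment> \<open>The vertex \<open>b\<close> that is cut off and its successor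
        \<open>c\<close> in the old chain are both joined to \<open>a\<close>, with no neighbour of
        \<open>a\<close> between them.\<close>
      ultimately have "triangle E' a b c"
        unfolding triangle_def using ab c bS low by (auto simp: row row_a)
      then show ?thesis by blast
    next
      case False
      then obtain x c where t: "triangle E x b c" using Tr[of b] ab by auto
      then have "a < x" using E[of x b] by (auto simp: triangle_def)
      then have "triangle E' x b c"
        using t ab(1) False S(1) unfolding triangle_def by (auto simp: row E'_def)
      then show ?thesis by blast
    qed
  qed
  ultimately have "partial_triangulation n d a E' C'"
    unfolding partial_triangulation_def by (intro conjI allI impI ballI) (assumption | blast)+
  then show ?thesis by blast
qed

lemma triangulation_exists:
  assumes d: "\<And>v. v \<le> n \<Longrightarrow> (\<Sum>a\<in>{v..n}. d a) \<le> n - v" and "(\<Sum>a\<in>{0..n}. d a) = n"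
  shows "\<exists>E. triangulation n E \<and> (\<forall>a\<le>n. card {b. E a b} = Suc (d a))"
proof -
  have "\<exists>E C. partial_triangulation n d r E C" if "r \<le> n + 1" for r
    using that
  proof (induction rule: inc_induct)
    case base
    have "partial_triangulation n d (n + 1) (\<lambda>_ _. False) {n + 1}"
      by (auto simp: partial_triangulation_def)
    then show ?case by blast
  next
    case (step a)
    then show ?case using partial_triangulation_step[of n d a] d[of a] by auto
  qed
  then obtain E C where P: "partial_triangulation n d 0 E C" by blast
  then have C: "C \<subseteq> {0..n + 1}" "0 \<in> C" "n + 1 \<in> C" "card C = 2"
    using assms(2) partial_triangulationD(3-6)[OF P] by simp_all
  \<comment> \<open>The degrees add up to \<open>n\<close>, so the chain has shrunk to its two ends:
    the long side is present and every other vertex is the middle of a triangle.\<close>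
  have C2: "C = {0, n + 1}"
    by (rule sym, rule card_subset_eq) (use C in \<open>auto intro: finite_subset\<close>)
  have "E 0 (n + 1)"
    using partial_triangulationD(7)[OF P] unfolding C2 by auto
  moreover have "\<forall>b\<in>{1..n}. \<exists>a c. triangle E a b c"
    using partial_triangulationD(8)[OF P] unfolding C2 by auto
  ultimately have "triangulation n E"
    using partial_triangulationD(1,2)[OF P] unfolding triangulation_def by simp
  moreover have "\<forall>a\<le>n. card {b. E a b} = Suc (d a)"
    using partial_triangulationD(2)[OF P] by simp
  ultimately show ?thesis by blast
qed

section \<open>The map \<open>rc_lambda\<close> is a bijection\<close>

definition elbows_below :: "nat \<Rightarrow> (nat \<times> nat) set \<Rightarrow> nat \<Rightarrow> nat" where
  "elbows_below n D v = card {p \<in> elbows n D. v < fst p}"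

lemma card_segments:
  assumes "D \<subseteq> nontrivial_positions (n + 1)" "a \<le> n"
  shows "elbows_below n D a + 1 = card {b. segment n D a b} + elbows_below n D (Suc a)"
proof -
  let ?R = "{p \<in> elbows n D. fst p = Suc a}"
  have fin: "finite {p \<in> elbows n D. P p}" for P using finite_elbows by simp
  have "{p \<in> elbows n D. a < fst p} = ?R \<union> {p \<in> elbows n D. Suc a < fst p}" by auto
  moreover have "?R \<inter> {p \<in> elbows n D. Suc a < fst p} = {}" by auto
  ultimately have e: "elbows_below n D a = card ?R + elbows_below n D (Suc a)"
    unfolding elbows_below_def using card_Un_disjoint[OF fin fin] by simp
  have pos: "1 \<le> snd p \<and> fst p + snd p \<le> n + 1" if "p \<in> elbows n D" for p
    using that by (auto simp: elbows_def nontrivial_positions_def)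
  have "{b. segment n D a b} = insert (Suc a) ((\<lambda>p. n + 2 - snd p) ` ?R)"
  proof (intro equalityI subsetI)
    fix b assume b: "b \<in> {b. segment n D a b}"
    show "b \<in> insert (Suc a) ((\<lambda>p. n + 2 - snd p) ` ?R)"
    proof (cases "b = Suc a")
      case False
      then have "(Suc a, n + 2 - b) \<in> ?R" "b = n + 2 - snd (Suc a, n + 2 - b)"
        using b by (auto simp: segment_def elbows_def nontrivial_positions_def)
      then show ?thesis by blast
    qed simp
  next
    fix b assume "b \<in> insert (Suc a) ((\<lambda>p. n + 2 - snd p) ` ?R)"
    then show "b \<in> {b. segment n D a b}"
      using segment_trivial[OF assms] by (auto simp: segment_def elbows_def nontrivial_positions_def)
  qed
  moreover have "Suc a \<notin> (\<lambda>p. n + 2 - snd p) ` ?R" using pos by force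
  moreover have "inj_on (\<lambda>p. n + 2 - snd p) ?R"
    using pos by (intro inj_onI) (fastforce simp: prod_eq_iff)
  ultimately have "card {b. segment n D a b} = Suc (card ?R)"
    using fin by (simp add: card_image)
  then show ?thesis using e by simp
qed

lemma elbows_below_0: "elbows_below n D 0 = card (elbows n D)"
  unfolding elbows_below_def
  by (rule arg_cong[of _ _ card]) (auto simp: elbows_def nontrivial_positions_def)

text \<open>An elbow in row \<open>i\<close> contributes the part \<open>i - 1\<close> to the
  conjugate, and this part reaches \<open>v\<close> exactly if the elbow lies below row
  \<open>v\<close>.\<close>

lemma young_diagram_rc_lambda:
  "young_diagram (rc_lambda n D) = {(v, c). 1 \<le> v \<and> 1 \<le> c \<and> c \<le> elbows_below n D v}"
proof -
  let ?q = "rev (sorted_list_of_multiset (elbow_parts n D))"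
  have q: "is_partition ?q" by (auto simp: is_partition_def sorted_wrt_rev elbow_parts_def)
  then have s: "sorted_wrt (\<ge>) ?q" by (simp add: is_partition_def)
  have len: "length (filter (\<lambda>x. v - 1 < x) ?q) = elbows_below n D v" if "1 \<le> v" for v
  proof -
    have "length (filter (\<lambda>x. v - 1 < x) ?q) = size (filter_mset (\<lambda>x. v - 1 < x) (elbow_parts n D))"
      by (metis mset_filter mset_rev mset_sorted_list_of_multiset size_mset)
    also have "\<dots> = size (filter_mset (\<lambda>p. v - 1 < fst p - 1) (mset_set (elbows n D)))"
      by (auto simp: elbow_parts_def filter_mset_image_mset filter_filter_mset case_prod_beta
          intro!: arg_cong[of _ _ size] filter_mset_cong)
    also have "\<dots> = card {p \<in> elbows n D. v - 1 < fst p - 1}"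
      using finite_elbows by (simp add: filter_mset_mset_set)
    also have "\<dots> = elbows_below n D v"
      unfolding elbows_below_def using that by (auto intro!: arg_cong[of _ _ card])
    finally show ?thesis .
  qed
  have "(v, c) \<in> young_diagram (rc_lambda n D) \<longleftrightarrow> 1 \<le> v \<and> 1 \<le> c \<and> c \<le> elbows_below n D v" for v c
  proof (cases "1 \<le> v \<and> 1 \<le> c")
    case True
    have "(v, c) \<in> young_diagram (rc_lambda n D) \<longleftrightarrow> (c, v) \<in> young_diagram ?q"
      unfolding rc_lambda_def using young_diagram_conjugate[OF q] .
    also have "\<dots> \<longleftrightarrow> c - 1 < length ?q \<and> v - 1 < ?q ! (c - 1)"
      using True by (auto simp: young_diagram_def)
    also have "\<dots> \<longleftrightarrow> c - 1 < elbows_below n D v"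
      using less_length_filter_iff[OF s, of "c - 1" "v - 1"] len[of v] True by simp
    finally show ?thesis using True by auto
  qed (auto simp: young_diagram_def)
  then show ?thesis by auto
qed

lemma RC_iff_triangulation:
  "D \<in> RC n \<longleftrightarrow> D \<subseteq> nontrivial_positions (n + 1) \<and> triangulation n (segment n D)"
  using has_exits_iff_RC has_exits_iff_triangulation has_exits_def by blast

lemma segment_inject:
  assumes "D \<subseteq> nontrivial_positions (n + 1)" "D' \<subseteq> nontrivial_positions (n + 1)"
    and "segment n D = segment n D'"
  shows "D = D'"
proof -
  have "(i, j) \<in> D \<longleftrightarrow> (i, j) \<in> D'" if "(i, j) \<in> nontrivial_positions (n + 1)" for i j
    using that fun_cong[OF fun_cong[OF assms(3)], of "i - 1" "n + 2 - j"]
    by (auto simp: segment_def nontrivial_positions_def)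
  then show ?thesis using assms(1,2) by auto
qed

lemma rc_lambda_inj: "inj_on (rc_lambda n) (RC n)"
proof (rule inj_onI)
  fix D D' assume D: "D \<in> RC n" "D' \<in> RC n" and eq: "rc_lambda n D = rc_lambda n D'"
  have sub: "D \<subseteq> nontrivial_positions (n + 1)" "D' \<subseteq> nontrivial_positions (n + 1)"
    using D RC_iff_triangulation by blast+
  have "elbows_below n D v = elbows_below n D' v" for v
  proof (cases "v = 0")
    \<comment> \<open>This value is no part of \<open>rc_lambda n D\<close>; it is the total number
      of elbows, which is always \<open>n\<close>.\<close>
    case True
    then show ?thesis using has_exits_turns(1) D unfolding has_exits_iff_RC by (simp add: elbows_below_0)
  next
    case False
    have "c \<le> elbows_below n D v \<longleftrightarrow> c \<le> elbows_below n D' v" if "1 \<le> c" for c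
    proof -
      have "(v, c) \<in> young_diagram (rc_lambda n D) \<longleftrightarrow> (v, c) \<in> young_diagram (rc_lambda n D')"
        using eq by simp
      then show ?thesis unfolding young_diagram_rc_lambda using False that by simp
    qed
    then show ?thesis by (metis One_nat_def Suc_leI le_antisym le_refl neq0_conv zero_le)
  qed
  then have "card {b. segment n D a b} = card {b. segment n D' a b}" if "a \<le> n" for a
    using card_segments[OF sub(1) that] card_segments[OF sub(2) that] by simp
  then have "segment n D = segment n D'"
    using D unfolding RC_iff_triangulation by (intro triangulation_eqI[of n]) auto
  then show "D = D'" by (rule segment_inject[OF sub])
qed

lemma rc_lambda_surj:
  assumes p: "p \<in> partitions_in_staircase n"
  shows "\<exists>D\<in>RC n. rc_lambda n D = p"
proof -
  have part: "is_partition p" and stair: "young_diagram p \<subseteq> young_diagram (staircase n)"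
    using p by (auto simp: partitions_in_staircase_def)
  \<comment> \<open>The prescribed values of \<open>elbows_below n D\<close>: the parts of
    \<open>p\<close>, preceded by the total number \<open>n\<close> of elbows.\<close>
  define h where "h v = (if v = 0 then n else if v \<le> length p then p ! (v - 1) else 0)" for v
  have hb: "h v \<le> n - v" for v
  proof (cases "1 \<le> v \<and> v \<le> length p")
    case True
    then have "p ! (v - 1) \<in> set p" by (intro nth_mem) auto
    then have "p ! (v - 1) \<noteq> 0" using part by (metis is_partition_def)
    then have "(v, p ! (v - 1)) \<in> young_diagram p" using True by (simp add: young_diagram_def)
    then have "(v, p ! (v - 1)) \<in> young_diagram (staircase n)" using stair by blast
    then show ?thesis using True by (auto simp: young_diagram_def staircase_def rev_nth h_def)
  qed (auto simp: h_def)
  have mono: "h (Suc v) \<le> h v" for v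
  proof (cases "v = 0")
    case True
    then show ?thesis using hb[of "Suc v"] by (simp add: h_def)
  next
    case False
    then show ?thesis
      using part by (auto simp: h_def is_partition_def sorted_wrt_iff_nth_less)
  qed
  \<comment> \<open>The number of elbows required in row \<open>v + 1\<close>, that is, of segments
    from \<open>v\<close> beyond the polygon side.\<close>
  define d where "d v = h v - h (Suc v)" for v
  have sum: "(\<Sum>a\<in>{v..n}. d a) = h v" if "v \<le> n" for v
    using that
  proof (induction rule: inc_induct)
    case base
    show ?case using hb[of "Suc n"] by (simp add: d_def)
  next
    case (step v)
    then show ?case using mono[of v] by (simp add: sum.atLeast_Suc_atMost d_def)
  qed
  obtain E where T: "triangulation n E" and row: "\<forall>a\<le>n. card {b. E a b} = Suc (d a)"
    using triangulation_exists[of n d] sum hb by (auto simp: h_def)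
  define D where "D = {(i, j) \<in> nontrivial_positions (n + 1). \<not> E (i - 1) (n + 2 - j)}"
  have sub: "D \<subseteq> nontrivial_positions (n + 1)" by (auto simp: D_def)
  have seg: "segment n D = E"
  proof (intro ext)
    fix a b
    show "segment n D a b = E a b"
    proof (cases "b = Suc a")
      case True
      then show ?thesis
        using triangulationD(2,3)[OF T, of a] segment_trivial[OF sub, of a]
        by (auto simp: segment_def)
    next
      case False
      then show ?thesis using triangulationD(1,2)[OF T, of a b]
        by (auto simp: segment_def D_def nontrivial_positions_def)
    qed
  qed
  have D: "D \<in> RC n" using sub T seg RC_iff_triangulation by simp
  have below: "elbows_below n D v = h v" if "v \<le> n + 1" for v
    using that
  proof (induction v)
    case 0
    then show ?case using has_exits_turns(1) D unfolding has_exits_iff_RC by (simp add: elbows_below_0 h_def)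
  next
    case (Suc v)
    then show ?case using card_segments[OF sub, of v] row mono[of v] unfolding seg by (simp add: d_def)
  qed
  have below': "elbows_below n D v = h v" for v
  proof (cases "v \<le> n + 1")
    case False
    then have "{p \<in> elbows n D. v < fst p} = {}" by (auto simp: elbows_def nontrivial_positions_def)
    then have "elbows_below n D v = 0" by (simp only: elbows_below_def card.empty)
    then show ?thesis using hb[of v] False by simp
  qed (rule below)
  have "young_diagram (rc_lambda n D) = young_diagram p"
    unfolding young_diagram_rc_lambda below' by (auto simp: young_diagram_def h_def split: if_splits)
  then have "rc_lambda n D = p" using young_diagram_inject[OF is_partition_rc_lambda part] by blast
  then show ?thesis using D by blast
qed

section \<open>Edelman-Greene insertion of reduced words\<close>

text \<open>Words are applied to \<open>g\<close> from their last letter to their first one, so the sweep word and the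
  words of tableaux below are reversed reading words.\<close>

definition reduces_to :: "nat list \<Rightarrow> nat list \<Rightarrow> bool" where
  "reduces_to u v \<longleftrightarrow> (\<forall>g. ascending g u \<longrightarrow> ascending g v \<and> foldl swap g v = foldl swap g u)"

lemma reduces_to_trans: "reduces_to u v \<Longrightarrow> reduces_to v w \<Longrightarrow> reduces_to u w"
  by (simp add: reduces_to_def)

lemma reduces_to_refl: "reduces_to u u"
  by (simp add: reduces_to_def)

lemma reduces_to_context: "reduces_to u v \<Longrightarrow> reduces_to (a @ u @ b) (a @ v @ b)"
  by (simp add: reduces_to_def ascending_append)

lemma reduces_to_commute:
  assumes "Suc x < y \<or> Suc y < x"
  shows "reduces_to [x, y] [y, x]"
  using assms by (auto simp: reduces_to_def swap_def fun_eq_iff)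

lemma reduces_to_braid: "reduces_to [x, Suc x, x] [Suc x, x, Suc x]"
  by (auto simp: reduces_to_def swap_def fun_eq_iff)

lemma reduces_to_move_right:
  assumes "\<forall>y\<in>set ys. Suc x < y \<or> Suc y < x"
  shows "reduces_to (x # ys) (ys @ [x])"
  using assms
proof (induction ys)
  case (Cons y ys)
  have "reduces_to ([] @ [x, y] @ ys) ([] @ [y, x] @ ys)"
    by (intro reduces_to_context reduces_to_commute) (use Cons.prems in auto)
  moreover have "reduces_to ([y] @ (x # ys) @ []) ([y] @ (ys @ [x]) @ [])"
    by (intro reduces_to_context Cons.IH) (use Cons.prems in auto)
  ultimately show ?case using reduces_to_trans by fastforce
qed (simp add: reduces_to_refl)

lemma not_ascending_square: "\<not> ascending g (u @ [x, x] @ v)"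
  by (simp add: ascending_append swap_def)

lemma strict_sorted_split:
  assumes "sorted_wrt (<) (R :: nat list)" "\<not> (\<forall>z\<in>set R. z \<le> x)"
  obtains A y B where "R = A @ y # B" "\<forall>z\<in>set A. z \<le> x" "x < y" "\<forall>z\<in>set B. y < z"
proof -
  obtain A y B where R: "R = A @ y # B" "x < y" "\<forall>z\<in>set A. \<not> x < z"
    using split_list_first_prop[of R "\<lambda>z. x < z"] assms(2) by (auto simp: not_le)
  show ?thesis by (rule that[OF R(1)]) (use R assms(1) in \<open>auto simp: sorted_wrt_append\<close>)
qed

text \<open>Reducedness rules out the insertions that would create a repeated entry: there \<open>x\<close> could be
  moved next to an equal letter.\<close>

lemma eg_row_insert_cases:
  assumes s: "sorted_wrt (<) R" and asc: "ascending g (x # rev R @ w)"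
  obtains (append) "\<forall>z\<in>set R. z < x" "eg_row_insert x R = (R @ [x], None)"
  | (bump) A y B where "R = A @ y # B" "\<forall>z\<in>set A. z < x" "x < y" "\<forall>z\<in>set B. y < z"
      "eg_row_insert x R = (A @ x # B, Some y)"
  | (keep) A B where "R = A @ x # Suc x # B" "\<forall>z\<in>set A. z < x" "\<forall>z\<in>set B. Suc x < z"
      "eg_row_insert x R = (R, Some (Suc x))"
proof (cases "\<forall>z\<in>set R. z \<le> x")
  case True
  have "x \<notin> set R"
  proof
    assume "x \<in> set R"
    then obtain A B where R: "R = A @ x # B" by (meson split_list)
    then have "B = []" using True s by (cases B) (auto simp: sorted_wrt_append)
    then have "x # rev R @ w = [] @ [x, x] @ (rev A @ w)" using R by simp
    then show False using asc not_ascending_square by metis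
  qed
  then have "\<forall>z\<in>set R. z < x" using True le_neq_implies_less by metis
  then show ?thesis using append True by (auto simp: eg_row_insert_def)
next
  case False
  then obtain A y B where R: "R = A @ y # B" "\<forall>z\<in>set A. z \<le> x" "x < y" "\<forall>z\<in>set B. y < z"
    using strict_sorted_split[OF s] by blast
  have "{z \<in> set R. x < z} = insert y (set B)" using R by auto
  then have "Min {z \<in> set R. x < z} = y" using R(4) by (auto intro!: Min_eqI)
  moreover have "map (\<lambda>z. if z = y then x else z) R = A @ x # B"
  proof -
    have "map (\<lambda>z. if z = y then x else z) A = A" using R(2,3) by (intro map_idI) auto
    moreover have "map (\<lambda>z. if z = y then x else z) B = B" using R(4) by (intro map_idI) auto
    ultimately show ?thesis using R(1) by simp
  qed
  ultimately have ins: "eg_row_insert x R = (A @ x # B, Some y)" if "\<not> (x \<in> set R \<and> x + 1 \<in> set R)"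
    using that False by (auto simp: eg_row_insert_def)
  show ?thesis
  proof (cases "x \<in> set A")
    case False
    then have "\<forall>z\<in>set A. z < x" using R(2) le_neq_implies_less by metis
    moreover have "x \<notin> set R" using R False by auto
    ultimately show ?thesis using bump[OF R(1)] R(3,4) ins by blast
  next
    case True
    then obtain A0 A1 where A: "A = A0 @ x # A1" by (meson split_list)
    then have "A1 = []" using R(1,2) s by (cases A1) (auto simp: sorted_wrt_append)
    then have A: "A = A0 @ [x]" using A by simp
    have A0: "\<forall>z\<in>set A0. z < x" using s R(1) A by (auto simp: sorted_wrt_append)
    have "y = Suc x"
    proof (rule ccontr)
      assume "y \<noteq> Suc x"
      then have "Suc x < y" using R(3) by simp
      then have "reduces_to (x # rev B @ [y]) ((rev B @ [y]) @ [x])"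
        using R(4) by (intro reduces_to_move_right) auto
      then have "reduces_to ([] @ (x # rev B @ [y]) @ (x # rev A0 @ w)) ([] @ ((rev B @ [y]) @ [x]) @ (x # rev A0 @ w))"
        by (rule reduces_to_context)
      then have "ascending g ((rev B @ [y]) @ [x, x] @ (rev A0 @ w))"
        using asc R(1) A unfolding reduces_to_def by simp
      then show False using not_ascending_square by blast
    qed
    moreover from this have "x \<in> set R" "x + 1 \<in> set R" using R(1) A by auto
    then have "eg_row_insert x R = (R, Some (Suc x))"
      using \<open>\<not> (\<forall>z\<in>set R. z \<le> x)\<close> by (simp add: eg_row_insert_def)
    ultimately show ?thesis using keep[of A0 B] R(1,4) A A0 by simp
  qed
qed

text \<open>When \<open>x\<close> bumps \<open>y\<close>, the letter \<open>x\<close> commutes past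
  the entries right of \<open>y\<close>, and \<open>y\<close> past those left of it. When the row
  contains \<open>x\<close> and \<open>Suc x\<close>, one braid move between two such commutations
  turns the inserted \<open>x\<close> into \<open>Suc x\<close>.\<close>

lemma eg_row_insert_reduces:
  assumes s: "sorted_wrt (<) R" and asc: "ascending g (x # rev R @ w)"
    and ins: "eg_row_insert x R = (R', Some y)"
  shows "reduces_to (x # rev R) (rev R' @ [y])"
  using s asc
proof (cases rule: eg_row_insert_cases)
  case append
  then show ?thesis using ins by simp
next
  case (bump A z B)
  then have z: "z = y" "R' = A @ x # B" using ins by auto
  have "reduces_to ([] @ (x # rev B) @ (y # rev A)) ([] @ (rev B @ [x]) @ (y # rev A))"
    using bump z by (intro reduces_to_context reduces_to_move_right) auto
  moreover have "reduces_to ((rev B @ [x]) @ (y # rev A) @ []) ((rev B @ [x]) @ (rev A @ [y]) @ [])"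
    using bump z by (intro reduces_to_context reduces_to_move_right) auto
  ultimately have "reduces_to (x # rev B @ y # rev A) (rev B @ x # rev A @ [y])"
    using reduces_to_trans by fastforce
  then show ?thesis using bump z by simp
next
  case (keep A B)
  then have z: "y = Suc x" "R' = R" using ins by auto
  have "reduces_to ([] @ (x # rev B) @ (Suc x # x # rev A)) ([] @ (rev B @ [x]) @ (Suc x # x # rev A))"
    using keep by (intro reduces_to_context reduces_to_move_right) auto
  moreover have "reduces_to (rev B @ [x, Suc x, x] @ rev A) (rev B @ [Suc x, x, Suc x] @ rev A)"
    by (intro reduces_to_context reduces_to_braid)
  moreover have "reduces_to ((rev B @ [Suc x, x]) @ (Suc x # rev A) @ []) ((rev B @ [Suc x, x]) @ (rev A @ [Suc x]) @ [])"
    using keep by (intro reduces_to_context reduces_to_move_right) auto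
  ultimately have "reduces_to (x # rev B @ Suc x # x # rev A) (rev B @ Suc x # x # rev A @ [Suc x])"
    unfolding append.simps append_assoc append_Nil2 by (blast intro: reduces_to_trans)
  then show ?thesis using keep z by simp
qed

section \<open>Insertion into strict tableaux\<close>

definition row_above :: "nat list \<Rightarrow> nat list \<Rightarrow> bool" where
  "row_above R S \<longleftrightarrow> length S \<le> length R \<and> (\<forall>p<length S. R ! p < S ! p)"

fun strict_tableau :: "nat list list \<Rightarrow> bool" where
  "strict_tableau [] \<longleftrightarrow> True"
| "strict_tableau (R # T) \<longleftrightarrow> R \<noteq> [] \<and> sorted_wrt (<) R \<and> strict_tableau T \<and>
    (\<forall>S T'. T = S # T' \<longrightarrow> row_above R S)"

definition tableau_word :: "nat list list \<Rightarrow> nat list" where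
  "tableau_word T = concat (map rev T)"

lemma tableau_word_simps [simp]:
  "tableau_word [] = []" "tableau_word (R # T) = rev R @ tableau_word T"
  by (simp_all add: tableau_word_def)

lemma sorted_nth_le_split:
  assumes "sorted_wrt (<) (A @ (x :: nat) # B)" "i \<le> length A"
  shows "(A @ x # B) ! i \<le> x"
proof (cases "i = length A")
  case False
  then have i: "i < length A" using assms(2) by simp
  have "\<forall>z\<in>set A. z < x" using assms(1) by (auto simp: sorted_wrt_append)
  then have "A ! i < x" using nth_mem[OF i] by blast
  then show ?thesis using i by (simp add: nth_append)
qed simp

text \<open>The letter \<open>y\<close> leaves the upper row at the position \<open>p\<close>, and enters the lower row weakly to
  the left of it.\<close>

lemma row_above_insert:
  assumes above: "row_above R S" and p: "p < length R" and len: "length R' = length R"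
    and le: "\<And>i. i < length R \<Longrightarrow> R' ! i \<le> R ! i"
    and less: "\<And>i. i \<le> p \<Longrightarrow> R' ! i < y"
    and S: "p < length S \<Longrightarrow> y \<le> S ! p"
    and s: "sorted_wrt (<) S" and asc: "ascending g (y # rev S @ w)"
  shows "row_above R' (fst (eg_row_insert y S))"
proof -
  have lt: "R' ! i < S ! i" if "i < length S" for i
    using le[of i] above that by (force simp: row_above_def)
  from s asc show ?thesis
  proof (cases rule: eg_row_insert_cases)
    case append
    have "length S \<le> p"
    proof (rule ccontr)
      assume "\<not> ?thesis"
      then have p': "p < length S" by simp
      then have "S ! p < y" using append(1) nth_mem by blast
      then show False using S[OF p'] by simp
    qed
    then show ?thesis
      using append(2) above p len less lt by (auto simp: row_above_def nth_append)
  next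
    case (bump A z B)
    have "length A \<le> p"
    proof (rule ccontr)
      assume "\<not> ?thesis"
      then have "S ! p \<in> set A" "p < length S" using bump(1) by (auto simp: nth_append)
      then show False using S bump(2) by force
    qed
    then have "R' ! i < (A @ y # B) ! i" if "i < length S" for i
    proof (cases "i = length A")
      case False
      then have "(A @ y # B) ! i = S ! i" using bump(1) by (auto simp: nth_append nth_Cons')
      then show ?thesis using lt[OF that] by simp
    qed (use less in simp)
    then show ?thesis using bump(1,5) above len by (auto simp: row_above_def)
  next
    case (keep A B)
    then show ?thesis using above len lt by (simp add: row_above_def)
  qed
qed

lemma eg_row_insert_above:
  assumes above: "row_above R S" and s: "sorted_wrt (<) R" "sorted_wrt (<) S"
    and asc: "ascending g (x # rev R @ w)" and ins: "eg_row_insert x R = (R', Some y)"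
    and asc': "ascending g' (y # rev S @ w')"
  shows "row_above R' (fst (eg_row_insert y S))"
  using s(1) asc
proof (cases rule: eg_row_insert_cases)
  case append
  then show ?thesis using ins by simp
next
  case (bump A z B)
  then have z: "z = y" "R' = A @ x # B" using ins by auto
  have sR': "sorted_wrt (<) (A @ x # B)" using s(1) bump by (auto simp: sorted_wrt_append)
  show ?thesis
  proof (rule row_above_insert[OF above, of "length A"])
    show "R' ! i \<le> R ! i" if "i < length R" for i
      using bump z by (auto simp: nth_append nth_Cons')
    show "R' ! i < y" if "i \<le> length A" for i
      using sorted_nth_le_split[OF sR' that] bump z by simp
    show "y \<le> S ! length A" if "length A < length S"
      using above that bump z by (auto simp: row_above_def)
  qed (use bump z s asc' in auto)
next
  case (keep A B)
  then have z: "y = Suc x" "R' = R" using ins by auto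
  show ?thesis
  proof (rule row_above_insert[OF above, of "length A"])
    show "R' ! i < y" if "i \<le> length A" for i
      using sorted_nth_le_split[OF s(1)[unfolded keep(1)] that] keep z by simp
    \<comment> \<open>Here \<open>R ! length A\<close> is \<open>x\<close>, one less than the letter
      passed on, so strictness down the column gives a weak inequality; this is the reason for the
      weak form in \<open>row_above_insert\<close>.\<close>
    show "y \<le> S ! length A" if "length A < length S"
      using above that keep z by (force simp: row_above_def)
  qed (use keep z s asc' in auto)
qed

text \<open>The second conjunct is \<open>reduces_to\<close> spelled out. It hands reducedness on to
  the next insertion, without which repeated entries could arise.\<close>

lemma eg_insert_strict_tableau:
  assumes "strict_tableau T" "ascending g (x # tableau_word T)"
  shows "strict_tableau (fst (eg_insert x T)) \<and>
    (\<forall>g. ascending g (x # tableau_word T) \<longrightarrow> ascending g (tableau_word (fst (eg_insert x T))) \<and>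
      foldl swap g (tableau_word (fst (eg_insert x T))) = foldl swap g (x # tableau_word T))"
  using assms
proof (induction T arbitrary: x g)
  case (Cons R T)
  have R: "R \<noteq> []" "sorted_wrt (<) R" "strict_tableau T" "\<And>S T'. T = S # T' \<Longrightarrow> row_above R S"
    using Cons.prems by auto
  have asc: "ascending g (x # rev R @ tableau_word T)" using Cons.prems by simp
  show ?case
  proof (cases "snd (eg_row_insert x R)")
    case None
    from R(2) asc show ?thesis
    proof (cases rule: eg_row_insert_cases)
      case append
      then show ?thesis using R
        by (auto simp: sorted_wrt_append row_above_def nth_append dest: order.strict_trans1)
    qed (use None in auto)
  next
    case (Some y)
    then obtain R' where ins: "eg_row_insert x R = (R', Some y)" by (cases "eg_row_insert x R") auto
    have fst: "fst (eg_insert x (R # T)) = R' # fst (eg_insert y T)"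
      using ins by (simp split: prod.split)
    have red: "reduces_to (x # rev R) (rev R' @ [y])" by (rule eg_row_insert_reduces[OF R(2) asc ins])
    have red': "ascending g (rev R' @ y # tableau_word T) \<and>
        foldl swap g (rev R' @ y # tableau_word T) = foldl swap g (x # rev R @ tableau_word T)"
      if "ascending g (x # rev R @ tableau_word T)" for g
      using reduces_to_context[OF red, of "[]" "tableau_word T"] that unfolding reduces_to_def by simp
    have asc': "ascending (foldl swap g (rev R')) (y # tableau_word T)"
      using red'[OF asc] by (simp only: ascending_append)
    have IH: "strict_tableau (fst (eg_insert y T))"
      "\<And>g. ascending g (y # tableau_word T) \<Longrightarrow> ascending g (tableau_word (fst (eg_insert y T))) \<and>
        foldl swap g (tableau_word (fst (eg_insert y T))) = foldl swap g (y # tableau_word T)"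
      using Cons.IH[OF R(3) asc'] by blast+
    have R': "R' \<noteq> [] \<and> sorted_wrt (<) R'"
      using R(2) asc
    proof (cases rule: eg_row_insert_cases)
      case (bump A z B)
      then show ?thesis using R(2) ins by (auto simp: sorted_wrt_append) (metis less_trans)
    qed (use R(1,2) ins in auto)
    have above: "row_above R' S" if S: "fst (eg_insert y T) = S # T'" for S T'
    proof (cases T)
      case Nil
      have "row_above R' (fst (eg_row_insert y []))"
        by (rule eg_row_insert_above[OF _ R(2) _ asc ins, where w' = "[]"])
          (use asc' Nil in \<open>auto simp: row_above_def\<close>)
      then show ?thesis using S Nil by (auto simp: eg_row_insert_def)
    next
      case (Cons S0 T0)
      have "row_above R' (fst (eg_row_insert y S0))"
        by (rule eg_row_insert_above[OF R(4)[OF Cons] R(2) _ asc ins, where w' = "tableau_word T0"])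
          (use asc' Cons R(3) in auto)
      then show ?thesis using S Cons by (auto split: prod.splits option.splits)
    qed
    have "ascending h (tableau_word (R' # fst (eg_insert y T))) \<and>
        foldl swap h (tableau_word (R' # fst (eg_insert y T))) = foldl swap h (x # tableau_word (R # T))"
      if "ascending h (x # tableau_word (R # T))" for h
      using red'[of h] IH(2)[of "foldl swap h (rev R')"] that by (simp add: ascending_append)
    then show ?thesis unfolding fst using R' IH(1) above by simp
  qed
qed (auto simp: row_above_def)

text \<open>Rows beyond the end count as empty, so that tableaux with different numbers of rows can
  be compared row by row.\<close>

definition tab_row :: "nat list list \<Rightarrow> nat \<Rightarrow> nat list" where
  "tab_row T i = (if i < length T then T ! i else [])"

lemma tab_row_simps [simp]:
  "tab_row [] i = []" "tab_row (R # T) 0 = R" "tab_row (R # T) (Suc i) = tab_row T i"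
  by (simp_all add: tab_row_def)

text \<open>The letter passed on and the remaining rows form a suffix of an equivalent reduced word;
  after the prefix it is ascending for another labelling. This drives the inductions over the
  rows.\<close>

lemma eg_insert_tail:
  assumes "strict_tableau (R # T)" "ascending g (x # tableau_word (R # T))"
    and "eg_row_insert x R = (R', Some y)"
  shows "\<exists>g. ascending g (y # tableau_word T)"
proof -
  have "reduces_to (x # rev R) (rev R' @ [y])"
    using assms by (intro eg_row_insert_reduces[of _ g _ "tableau_word T"]) auto
  then have "reduces_to ([] @ (x # rev R) @ tableau_word T) ([] @ (rev R' @ [y]) @ tableau_word T)"
    by (rule reduces_to_context)
  then have "ascending g (rev R' @ y # tableau_word T)"
    using assms(2) unfolding reduces_to_def by simp
  then show ?thesis unfolding ascending_append by blast
qed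

lemma eg_insert_Cons_Some:
  "eg_row_insert x R = (R', Some y) \<Longrightarrow>
    eg_insert x (R # T) = (R' # fst (eg_insert y T), Suc (snd (eg_insert y T)))"
  by (simp split: prod.split)

text \<open>Each row passes on a letter larger than the one it received, so the letter entering row
  \<open>i\<close> is at least \<open>b + i\<close>, and any entry that it displaces is larger
  still.\<close>

lemma eg_insert_small_entries:
  assumes "strict_tableau T" "ascending g (x # tableau_word T)" "b \<le> x"
  shows "filter (\<lambda>z. z < b + i) (tab_row (fst (eg_insert x T)) i) = filter (\<lambda>z. z < b + i) (tab_row T i)"
  using assms
proof (induction T arbitrary: x g b i)
  case Nil
  then show ?case by (cases i) auto
next
  case (Cons R T)
  have R: "sorted_wrt (<) R" "strict_tableau T" using Cons.prems by auto
  have asc: "ascending g (x # rev R @ tableau_word T)" using Cons.prems by simp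
  have tail: "filter (\<lambda>z. z < b + Suc k) (tab_row (fst (eg_insert y T)) k) =
      filter (\<lambda>z. z < b + Suc k) (tab_row T k)"
    if y: "eg_row_insert x R = (R', Some y)" "x < y" for R' y k
    using Cons.IH[OF R(2), of _ y "Suc b" k] eg_insert_tail[OF Cons.prems(1,2) y(1)] y(2) Cons.prems(3)
    by auto
  from R(1) asc show ?case
  proof (cases rule: eg_row_insert_cases)
    case append
    then show ?thesis using Cons.prems(3) by (cases i) auto
  next
    case (bump A y B)
    then show ?thesis using tail[OF bump(5,3)] Cons.prems(3) eg_insert_Cons_Some[OF bump(5), of T]
      by (cases i) auto
  next
    case (keep A B)
    then show ?thesis using tail[OF keep(4)] eg_insert_Cons_Some[OF keep(4), of T]
      by (cases i) auto
  qed
qed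

lemma eg_insert_entries:
  assumes "strict_tableau T" "ascending g (x # tableau_word T)"
  shows "set (concat (fst (eg_insert x T))) \<subseteq> insert x (set (concat T))"
  using assms
proof (induction T arbitrary: x g)
  case (Cons R T)
  have R: "sorted_wrt (<) R" "strict_tableau T" using Cons.prems by auto
  have asc: "ascending g (x # rev R @ tableau_word T)" using Cons.prems by simp
  have tail: "set (concat (fst (eg_insert y T))) \<subseteq> insert y (set (concat T))"
    if y: "eg_row_insert x R = (R', Some y)" for R' y
    using Cons.IH[OF R(2)] eg_insert_tail[OF Cons.prems(1,2) y] by blast
  from R(1) asc show ?case
  proof (cases rule: eg_row_insert_cases)
    case append
    then show ?thesis by auto
  next
    case (bump A y B)
    then show ?thesis using tail[OF bump(5)] eg_insert_Cons_Some[OF bump(5), of T] by auto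
  next
    case (keep A B)
    then show ?thesis using tail[OF keep(4)] eg_insert_Cons_Some[OF keep(4), of T] by auto
  qed
qed auto

lemma eg_insert_first_row:
  assumes "strict_tableau T" "ascending g (x # tableau_word T)"
  shows "x \<in> set (tab_row (fst (eg_insert x T)) 0)"
    and "length (tab_row (fst (eg_insert x T)) 0) \<le> Suc (length (tab_row T 0))"
    and "z \<in> set (tab_row T 0) \<Longrightarrow> x < z \<Longrightarrow>
      length (tab_row (fst (eg_insert x T)) 0) = length (tab_row T 0)"
proof -
  have "x \<in> set (tab_row (fst (eg_insert x T)) 0) \<and>
    length (tab_row (fst (eg_insert x T)) 0) \<le> Suc (length (tab_row T 0)) \<and>
    (\<forall>z\<in>set (tab_row T 0). x < z \<longrightarrow> length (tab_row (fst (eg_insert x T)) 0) = length (tab_row T 0))"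
  proof (cases T)
    case (Cons R T')
    then have "sorted_wrt (<) R" "ascending g (x # rev R @ tableau_word T')" using assms by auto
    then show ?thesis
    proof (cases rule: eg_row_insert_cases)
      case append
      then show ?thesis using Cons by auto
    next
      case (bump A y B)
      then show ?thesis using Cons eg_insert_Cons_Some[OF bump(5), of T'] by auto
    next
      case (keep A B)
      then show ?thesis using Cons eg_insert_Cons_Some[OF keep(4), of T'] by auto
    qed
  qed auto
  then show "x \<in> set (tab_row (fst (eg_insert x T)) 0)"
    and "length (tab_row (fst (eg_insert x T)) 0) \<le> Suc (length (tab_row T 0))"
    and "z \<in> set (tab_row T 0) \<Longrightarrow> x < z \<Longrightarrow>
      length (tab_row (fst (eg_insert x T)) 0) = length (tab_row T 0)" by blast+
qed

text \<open>Applying \<open>record_label\<close> to the insertion tableau itself is a device for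
  naming the shape with one more box; the lengths do not depend on the label
  \<open>a\<close>.\<close>

lemma eg_insert_shape:
  "snd (eg_insert x T) \<le> length T \<and>
    map length (fst (eg_insert x T)) = map length (record_label a (snd (eg_insert x T)) T)"
proof (induction T arbitrary: x)
  case Nil
  then show ?case by (simp add: record_label_def)
next
  case (Cons R T)
  obtain R' y where ins: "eg_row_insert x R = (R', y)" by (cases "eg_row_insert x R")
  show ?case
  proof (cases y)
    case None
    then have "length R' = Suc (length R)"
      using ins by (auto simp: eg_row_insert_def Let_def split: if_splits)
    then show ?thesis using ins None by (simp add: record_label_def)
  next
    case (Some z)
    then have "length R' = length R"
      using ins by (auto simp: eg_row_insert_def Let_def split: if_splits)
    then show ?thesis using ins Some Cons.IH[of z] eg_insert_Cons_Some[of x R R' z T]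
      by (simp add: record_label_def split: if_splits)
  qed
qed

lemma tab_row_record_label:
  "r \<le> length Q \<Longrightarrow> tab_row (record_label a r Q) i = (if i = r then tab_row Q i @ [a] else tab_row Q i)"
  by (auto simp: tab_row_def record_label_def nth_append)

lemma sum_list_record_label:
  "r \<le> length Q \<Longrightarrow> sum_list (map length (record_label a r Q)) = Suc (sum_list (map length Q))"
proof (induction Q arbitrary: r)
  case (Cons R Q)
  show ?case
  proof (cases r)
    case (Suc k)
    then show ?thesis using Cons.IH[of k] Cons.prems by (simp add: record_label_def split: if_splits)
  qed (simp add: record_label_def)
qed (simp add: record_label_def)

lemma length_tab_row_cong:
  assumes "map length P = map length Q"
  shows "length (tab_row P i) = length (tab_row Q i)"
proof -
  have "length P = length Q" using assms by (metis length_map)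
  then show ?thesis using assms by (auto simp: tab_row_def dest!: arg_cong[of _ _ "\<lambda>l. l ! i"])
qed

section \<open>Inserting a word\<close>

definition insert_letters :: "nat list \<Rightarrow> nat list list \<Rightarrow> nat list list" where
  "insert_letters xs T = foldl (\<lambda>T x. fst (eg_insert x T)) T xs"

lemma insert_letters_simps [simp]:
  "insert_letters [] T = T" "insert_letters (x # xs) T = insert_letters xs (fst (eg_insert x T))"
  by (simp_all add: insert_letters_def)

lemma insert_letters_append: "insert_letters (xs @ ys) T = insert_letters ys (insert_letters xs T)"
  by (simp add: insert_letters_def)

definition cell_letters :: "(nat \<times> nat) list \<Rightarrow> nat list" where
  "cell_letters = map (\<lambda>(i, j). i + j)"

lemma fold_eg_step:
  assumes "map length P = map length Q" "fold eg_step cs (P, Q) = (P', Q')"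
  shows "map length P' = map length Q' \<and> P' = insert_letters (cell_letters cs) P \<and>
    (\<forall>i. \<exists>zs. tab_row Q' i = tab_row Q i @ zs \<and> set zs \<subseteq> fst ` set cs) \<and>
    sum_list (map length P') = sum_list (map length P) + length cs"
  using assms
proof (induction cs arbitrary: P Q)
  case (Cons c cs)
  obtain i j where c: "c = (i, j)" by (cases c)
  define r where "r = snd (eg_insert (i + j) P)"
  have r: "r \<le> length P" "map length (fst (eg_insert (i + j) P)) = map length (record_label i r P)"
    using eg_insert_shape[of "i + j" P i] by (auto simp: r_def)
  have lPQ: "length P = length Q" using Cons.prems(1) by (metis length_map)
  have rec: "map length (record_label i r P) = map length (record_label i r Q)"
    using Cons.prems(1) lPQ r(1)
    by (auto simp: record_label_def map_update) (metis length_append length_map nth_map)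
  have step: "eg_step c (P, Q) = (fst (eg_insert (i + j) P), record_label i r Q)"
    by (simp add: eg_step_def c r_def split: prod.split)
  have IH: "map length P' = map length Q'" "P' = insert_letters (cell_letters cs) (fst (eg_insert (i + j) P))"
    "\<And>k. \<exists>zs. tab_row Q' k = tab_row (record_label i r Q) k @ zs \<and> set zs \<subseteq> fst ` set cs"
    "sum_list (map length P') = sum_list (map length (fst (eg_insert (i + j) P))) + length cs"
    using Cons.IH[of "fst (eg_insert (i + j) P)" "record_label i r Q"] Cons.prems(2) r(2) rec step by auto
  have "\<exists>zs. tab_row Q' k = tab_row Q k @ zs \<and> set zs \<subseteq> fst ` set (c # cs)" for k
  proof -
    obtain zs where zs: "tab_row Q' k = tab_row (record_label i r Q) k @ zs" "set zs \<subseteq> fst ` set cs"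
      using IH(3) by blast
    have "tab_row Q' k = tab_row Q k @ ((if k = r then [i] else []) @ zs)"
      using zs(1) r(1) lPQ by (simp add: tab_row_record_label)
    then show ?thesis using zs(2) c by (intro exI[of _ "(if k = r then [i] else []) @ zs"]) auto
  qed
  moreover have "sum_list (map length (fst (eg_insert (i + j) P))) = Suc (sum_list (map length P))"
    using r sum_list_record_label by metis
  ultimately show ?case using IH c by (simp add: cell_letters_def)
qed (simp add: cell_letters_def)

text \<open>The invariant of successive insertion: the pending letters and the tableau together
  spell a reduced word, in reversed reading order.\<close>

definition insertable :: "nat list \<Rightarrow> nat list list \<Rightarrow> bool" where
  "insertable xs T \<longleftrightarrow> strict_tableau T \<and> (\<exists>g. ascending g (rev xs @ tableau_word T))"

lemma insertable_Cons:
  assumes "insertable (x # xs) T"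
  shows "strict_tableau T" "\<exists>g. ascending g (x # tableau_word T)" "insertable xs (fst (eg_insert x T))"
proof -
  obtain g where T: "strict_tableau T" and "ascending g (rev xs @ x # tableau_word T)"
    using assms by (auto simp: insertable_def)
  then have g: "ascending g (rev xs)" "ascending (foldl swap g (rev xs)) (x # tableau_word T)"
    unfolding ascending_append by blast+
  show "strict_tableau T" "\<exists>g. ascending g (x # tableau_word T)" using T g by blast+
  show "insertable xs (fst (eg_insert x T))"
    using eg_insert_strict_tableau[OF T g(2)] g unfolding insertable_def ascending_append by blast
qed

lemma insertable_appendD:
  assumes "insertable (xs @ ys) T"
  shows "insertable ys (insert_letters xs T)" "insertable xs T"
proof -
  show "insertable ys (insert_letters xs T)"
    using assms by (induction xs arbitrary: T) (use insertable_Cons(3) in auto)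
  show "insertable xs T"
    using assms unfolding insertable_def by (auto simp: ascending_append)
qed

lemma insert_letters_small_entries:
  assumes "insertable xs T" "\<forall>x\<in>set xs. b \<le> x"
  shows "filter (\<lambda>z. z < b + i) (tab_row (insert_letters xs T) i) = filter (\<lambda>z. z < b + i) (tab_row T i)"
  using assms
proof (induction xs arbitrary: T)
  case (Cons x xs)
  then show ?case
    using insertable_Cons[OF Cons.prems(1)] eg_insert_small_entries[of T _ x b i] by auto
qed simp

lemma insert_letters_entries:
  assumes "insertable xs T"
  shows "set (concat (insert_letters xs T)) \<subseteq> set xs \<union> set (concat T)"
  using assms
proof (induction xs arbitrary: T)
  case (Cons x xs)
  obtain g where g: "ascending g (x # tableau_word T)" using insertable_Cons(2)[OF Cons.prems] by blast
  show ?case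
    using Cons.IH[OF insertable_Cons(3)[OF Cons.prems]]
      eg_insert_entries[OF insertable_Cons(1)[OF Cons.prems] g] by auto
qed simp

text \<open>Once inserted, a letter stands in the first row. The next one is smaller, so it cannot
  be appended there; only the first letter can lengthen that row.\<close>

lemma insert_letters_decreasing:
  assumes "insertable xs T" "sorted_wrt (>) xs"
  shows "length (tab_row (insert_letters xs T) 0) \<le> Suc (length (tab_row T 0))"
proof -
  have same: "length (tab_row (insert_letters xs T) 0) = length (tab_row T 0)"
    if "insertable xs T" "sorted_wrt (>) xs" "z \<in> set (tab_row T 0)" "\<forall>x\<in>set xs. x < z" for xs T z
    using that
  proof (induction xs arbitrary: T z)
    case (Cons x xs)
    obtain g where g: "ascending g (x # tableau_word T)" using insertable_Cons(2)[OF Cons.prems(1)] by blast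
    note r = eg_insert_first_row[OF insertable_Cons(1)[OF Cons.prems(1)] g]
    show ?case
      using Cons.IH[OF insertable_Cons(3)[OF Cons.prems(1)] _ r(1)] r(3)[of z] Cons.prems by auto
  qed simp
  show ?thesis
  proof (cases xs)
    case (Cons x ys)
    note i = assms(1)[unfolded Cons]
    obtain g where g: "ascending g (x # tableau_word T)" using insertable_Cons(2)[OF i] by blast
    note r = eg_insert_first_row[OF insertable_Cons(1)[OF i] g]
    show ?thesis using same[OF insertable_Cons(3)[OF i] _ r(1)] r(2) assms(2) Cons by auto
  qed simp
qed

lemma strict_tableau_row:
  assumes "strict_tableau T" "i < length T"
  shows "T ! i \<noteq> []" "sorted_wrt (<) (T ! i)"
  using assms by (induction T arbitrary: i) (auto simp: nth_Cons' less_Suc_eq_0_disj)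

lemma strict_tableau_entry_ge:
  assumes "strict_tableau T" "\<forall>z\<in>set (tab_row T 0). k \<le> z" "i < length T" "z \<in> set (T ! i)"
  shows "k + i \<le> z"
  using assms
proof (induction T arbitrary: k i)
  case (Cons R T)
  show ?case
  proof (cases i)
    case 0
    then show ?thesis using Cons.prems by simp
  next
    case (Suc l)
    have "\<forall>z\<in>set (tab_row T 0). Suc k \<le> z"
    proof (cases T)
      case (Cons S T')
      have above: "row_above R S" using Cons.prems(1) Cons by simp
      show ?thesis
      proof
        fix z assume "z \<in> set (tab_row T 0)"
        then obtain p where p: "p < length S" "z = S ! p" using Cons by (auto simp: in_set_conv_nth)
        then have "R ! p < z" "R ! p \<in> set R" using above by (auto simp: row_above_def)
        then show "Suc k \<le> z" using Cons.prems(2) by force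
      qed
    qed simp
    then have "Suc k + l \<le> z" using Cons.IH[of "Suc k" l] Cons.prems Suc by simp
    then show ?thesis using Suc by simp
  qed
qed simp

text \<open>Strict columns confine row \<open>i\<close> to the interval from \<open>i + 3\<close> to
  \<open>n + 1\<close>, so it has at most \<open>n - 1 - i\<close> boxes. The given size leaves no
  slack, and each row is its whole interval.\<close>

lemma staircase_tableau:
  assumes T: "strict_tableau T" and e: "\<forall>z\<in>set (concat T). 3 \<le> z \<and> z \<le> n + 1"
    and sum: "sum_list (map length T) = (\<Sum>i<n - 1. n - 1 - i)"
  shows "length T = n - 1" "i < n - 1 \<Longrightarrow> T ! i = [i + 3..<n + 2]"
proof -
  have sub: "set (T ! i) \<subseteq> {i + 3..<n + 2}" if "i < length T" for i
  proof
    fix z assume z: "z \<in> set (T ! i)"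
    have "\<forall>z\<in>set (tab_row T 0). 3 \<le> z" using e by (cases T) auto
    then have "3 + i \<le> z" by (rule strict_tableau_entry_ge[OF T _ that z])
    moreover have "z \<in> set (concat T)" using z nth_mem[OF that] by auto
    then have "z \<le> n + 1" using e by blast
    ultimately show "z \<in> {i + 3..<n + 2}" by simp
  qed
  have card: "card (set (T ! i)) = length (T ! i)" if "i < length T" for i
    using strict_tableau_row(2)[OF T that] by (simp add: distinct_card strict_sorted_iff)
  have le: "length (T ! i) \<le> n - 1 - i" if "i < length T" for i
    using card_mono[OF _ sub[OF that]] card[OF that] by simp
  have lT: "length T \<le> n - 1"
  proof (cases "length T = 0")
    case False
    then have "T ! (length T - 1) \<noteq> []" using strict_tableau_row(1)[OF T] by simp
    then have "0 < length (T ! (length T - 1))" by simp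
    also have "\<dots> \<le> n - 1 - (length T - 1)" using le[of "length T - 1"] False by simp
    finally show ?thesis by simp
  qed simp
  have "sum_list (map length T) = (\<Sum>i<length T. length (T ! i))"
    by (simp add: sum_list_sum_nth atLeast0LessThan)
  also have "\<dots> = (\<Sum>i<n - 1. length (tab_row T i))"
    by (rule sum.mono_neutral_cong_left) (use lT in \<open>auto simp: tab_row_def\<close>)
  finally have eq: "(\<Sum>i<n - 1. length (tab_row T i)) = (\<Sum>i<n - 1. n - 1 - i)" using sum by simp
  have full: "length (tab_row T i) = n - 1 - i" if i: "i < n - 1" for i
  proof (rule ccontr)
    assume "length (tab_row T i) \<noteq> n - 1 - i"
    then have "(\<Sum>i<n - 1. length (tab_row T i)) < (\<Sum>i<n - 1. n - 1 - i)"
      using le i by (intro sum_strict_mono_ex1) (auto simp: tab_row_def intro!: bexI[of _ i] le_neq_implies_less)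
    then show False using eq by simp
  qed
  have "i < length T" if "i < n - 1" for i
    using full[OF that] that by (auto simp: tab_row_def split: if_splits)
  then show "length T = n - 1" using lT by (metis le_neq_implies_less less_irrefl)
  show "T ! i = [i + 3..<n + 2]" if i: "i < n - 1"
  proof -
    have iT: "i < length T" using i \<open>length T = n - 1\<close> by simp
    have "set (T ! i) = {i + 3..<n + 2}"
    proof (rule card_subset_eq[OF _ sub[OF iT]])
      have "length (T ! i) = n - 1 - i" using full[OF i] iT by (simp add: tab_row_def)
      then show "card (set (T ! i)) = card {i + 3..<n + 2}" using card[OF iT] by simp
    qed simp
    then show ?thesis
      by (intro strict_sorted_equal[OF _ strict_tableau_row(2)[OF T iT]]) (simp_all only: strict_sorted_iff sorted_upt distinct_upt set_upt)
  qed
qed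

section \<open>Insertion of the rows of an rc-graph\<close>

definition cells_between :: "nat \<Rightarrow> (nat \<times> nat) set \<Rightarrow> nat \<Rightarrow> nat \<Rightarrow> (nat \<times> nat) list" where
  "cells_between m D a b = filter (\<lambda>p. p \<in> D) (List.product [a..<b] (rev [1..<m + 1]))"

lemma reading_order_cells: "reading_order m D = cells_between m D 1 (m + 1)"
  by (simp add: reading_order_def cells_between_def product_concat_map)

lemma cells_between_append:
  assumes "a \<le> b" "b \<le> c"
  shows "cells_between m D a c = cells_between m D a b @ cells_between m D b c"
proof -
  have "[a..<c] = [a..<b] @ [b..<c]" using assms upt_add_eq_append[of a b "c - b"] by simp
  then show ?thesis by (simp add: cells_between_def product_concat_map)
qed

lemma set_cells_between:
  assumes "D \<subseteq> nontrivial_positions m"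
  shows "set (cells_between m D a b) = {p \<in> D. a \<le> fst p \<and> fst p < b}"
  using assms by (auto simp: cells_between_def nontrivial_positions_def)

lemma length_cells_between:
  assumes "D \<subseteq> nontrivial_positions m"
  shows "length (cells_between m D a b) = card {p \<in> D. a \<le> fst p \<and> fst p < b}"
proof -
  have "distinct (cells_between m D a b)" by (simp add: cells_between_def distinct_product)
  then show ?thesis using distinct_card set_cells_between[OF assms] by metis
qed

lemma cells_between_Suc:
  "cells_between m D i (Suc i) = map (Pair i) (filter (\<lambda>j. (i, j) \<in> D) (rev [1..<m + 1]))"
  by (simp add: cells_between_def filter_map comp_def)

text \<open>The sweep visits the crosses in the opposite of the reading order; this carries
  reducedness from the strands over to the inserted word.\<close>

lemma sweep_letters_reading_order: "rev (cell_letters (reading_order m D)) = sweep_letters m D"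
proof -
  have row: "rev (cell_letters (filter (\<lambda>p. p \<in> D) (map (Pair i) (rev [1..<m + 1])))) = row_letters D i (m + 1)" for i
    by (simp add: cell_letters_def row_letters_def rev_map rev_filter filter_map comp_def)
  have "cell_letters (reading_order m D) =
      concat (map (\<lambda>i. cell_letters (filter (\<lambda>p. p \<in> D) (map (Pair i) (rev [1..<m + 1])))) [1..<m + 1])"
    by (simp add: reading_order_def cell_letters_def filter_concat map_concat comp_def)
  then show ?thesis
    using row by (simp add: rev_concat rev_map comp_def sweep_letters_def)
qed

lemma length_tab_row_antimono:
  assumes "strict_tableau T" "i \<le> j"
  shows "length (tab_row T j) \<le> length (tab_row T i)"
proof -
  have "length (tab_row T (Suc i)) \<le> length (tab_row T i)" for i
    using assms(1)
  proof (induction T arbitrary: i)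
    case (Cons R T)
    show ?case
    proof (cases i)
      case 0
      then show ?thesis using Cons.prems by (cases T) (auto simp: row_above_def)
    next
      case (Suc k)
      then show ?thesis using Cons.IH[of k] Cons.prems by simp
    qed
  qed simp
  then show ?thesis by (rule lift_Suc_antimono_le[OF _ assms(2)])
qed

lemma sum_list_tab_row:
  assumes "length T \<le> k"
  shows "sum_list (map length T) = (\<Sum>i<k. length (tab_row T i))"
proof -
  have "sum_list (map length T) = (\<Sum>i<length T. length (T ! i))"
    by (simp add: sum_list_sum_nth atLeast0LessThan)
  also have "\<dots> = (\<Sum>i<k. length (tab_row T i))"
    by (rule sum.mono_neutral_cong_left) (use assms in \<open>auto simp: tab_row_def\<close>)
  finally show ?thesis .
qed

lemma initial_set_eq:
  fixes H :: "nat set"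
  assumes "finite H" "\<And>i j. j \<in> H \<Longrightarrow> i \<le> j \<Longrightarrow> i \<in> H"
  shows "H = {..<card H}"
proof -
  define k where "k = (LEAST i. i \<notin> H)"
  have "\<exists>i. i \<notin> H" using assms(1) infinite_UNIV_nat by (metis UNIV_eq_I)
  then have k: "k \<notin> H" unfolding k_def by (rule LeastI_ex)
  have "i \<in> H" if "i < k" for i using not_less_Least that unfolding k_def by blast
  moreover have "i < k" if "i \<in> H" for i using assms(2)[OF that, of k] k by (meson not_less)
  ultimately have "H = {..<k}" by blast
  then show ?thesis by simp
qed

text \<open>Kept untransposed, so column \<open>r\<close> here becomes row \<open>r\<close> of
  \<open>Q_tableau\<close>. The stages are whole rows of \<open>D\<close> because all crosses of a
  row record the same label.\<close>

definition eg_stage :: "nat \<Rightarrow> (nat \<times> nat) set \<Rightarrow> nat \<Rightarrow> nat list list \<times> nat list list" where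
  "eg_stage m D r = fold eg_step (cells_between m D 1 (r + 1)) ([], [])"

lemma eg_stage_later:
  assumes "r \<le> s"
  shows "eg_stage m D s = fold eg_step (cells_between m D (r + 1) (s + 1)) (eg_stage m D r)"
  using assms cells_between_append[of 1 "r + 1" "s + 1" m D] by (simp add: eg_stage_def)

lemma eg_stage_shape:
  "map length (fst (eg_stage m D r)) = map length (snd (eg_stage m D r))"
  "fst (eg_stage m D r) = insert_letters (cell_letters (cells_between m D 1 (r + 1))) []"
  "sum_list (map length (fst (eg_stage m D r))) = length (cells_between m D 1 (r + 1))"
proof -
  have "fold eg_step (cells_between m D 1 (r + 1)) ([], []) = (fst (eg_stage m D r), snd (eg_stage m D r))"
    by (simp add: eg_stage_def)
  from fold_eg_step[OF refl this]
  show "map length (fst (eg_stage m D r)) = map length (snd (eg_stage m D r))"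
    "fst (eg_stage m D r) = insert_letters (cell_letters (cells_between m D 1 (r + 1))) []"
    "sum_list (map length (fst (eg_stage m D r))) = length (cells_between m D 1 (r + 1))"
    by auto
qed

lemma eg_stage_recording:
  assumes "D \<subseteq> nontrivial_positions m" "r \<le> s"
  obtains zs where "tab_row (snd (eg_stage m D s)) i = tab_row (snd (eg_stage m D r)) i @ zs"
    "\<forall>z\<in>set zs. r < z \<and> z \<le> s"
proof -
  have "\<exists>zs. tab_row (snd (eg_stage m D s)) i = tab_row (snd (eg_stage m D r)) i @ zs \<and>
      set zs \<subseteq> fst ` set (cells_between m D (r + 1) (s + 1))"
  proof -
    have "fold eg_step (cells_between m D (r + 1) (s + 1)) (fst (eg_stage m D r), snd (eg_stage m D r)) =
        (fst (eg_stage m D s), snd (eg_stage m D s))"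
      using eg_stage_later[OF assms(2), of m D] by simp
    from fold_eg_step[OF eg_stage_shape(1) this] show ?thesis by blast
  qed
  then show ?thesis using that set_cells_between[OF assms(1)] by fastforce
qed

lemma eg_stage_tab_row_prefix:
  assumes "D \<subseteq> nontrivial_positions m" "r \<le> s"
  shows "length (tab_row (fst (eg_stage m D r)) i) \<le> length (tab_row (fst (eg_stage m D s)) i)"
  using eg_stage_recording[OF assms, of i] length_tab_row_cong[OF eg_stage_shape(1)]
  by (metis le_add1 length_append)

lemma rc_insertable:
  assumes "D \<in> RC n"
  shows "insertable (cell_letters (reading_order (n + 1) D)) []"
  using ascending_sweep[OF assms] sweep_letters_reading_order by (auto simp: insertable_def)

lemma rc_insertable_stage:
  assumes "D \<in> RC n" "r \<le> s" "s \<le> n + 1"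
  shows "insertable (cell_letters (cells_between (n + 1) D (r + 1) (s + 1))) (fst (eg_stage (n + 1) D r))"
    and "strict_tableau (fst (eg_stage (n + 1) D r))"
proof -
  have "cell_letters (reading_order (n + 1) D) =
      cell_letters (cells_between (n + 1) D 1 (r + 1)) @
      (cell_letters (cells_between (n + 1) D (r + 1) (s + 1)) @ cell_letters (cells_between (n + 1) D (s + 1) (n + 1 + 1)))"
    using cells_between_append[of 1 "r + 1" "n + 1 + 1" "n + 1" D]
      cells_between_append[of "r + 1" "s + 1" "n + 1 + 1" "n + 1" D] assms(2,3)
    by (simp add: reading_order_cells cell_letters_def)
  then show 1: "insertable (cell_letters (cells_between (n + 1) D (r + 1) (s + 1))) (fst (eg_stage (n + 1) D r))"
    using rc_insertable[OF assms(1)] insertable_appendD unfolding eg_stage_shape(2) by metis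
  then show "strict_tableau (fst (eg_stage (n + 1) D r))" by (simp add: insertable_def)
qed

text \<open>The rows below \<open>r\<close> have a triangular number of nontrivial positions; this
  converts counts of crosses into counts of elbows.\<close>

lemma card_rows_below:
  assumes D: "D \<subseteq> nontrivial_positions (n + 1)"
  shows "length (cells_between (n + 1) D (r + 1) (n + 2)) + elbows_below n D r = (\<Sum>i<n - r. n - r - i)"
proof -
  let ?X = "{p \<in> nontrivial_positions (n + 1). r < fst p}"
  have "{p \<in> D. r + 1 \<le> fst p \<and> fst p < n + 2} = {p \<in> ?X. p \<in> D}"
    using D by (auto simp: nontrivial_positions_def)
  moreover have "{p \<in> elbows n D. r < fst p} = {p \<in> ?X. p \<notin> D}" by (auto simp: elbows_def)
  moreover have "finite ?X" using finite_nontrivial_positions by simp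
  then have "card {p \<in> ?X. p \<in> D} + card {p \<in> ?X. p \<notin> D} = card ?X"
    by (subst card_Un_disjoint[symmetric]) (auto intro!: arg_cong[of _ _ card] elim: rev_finite_subset)
  moreover have "?X = (SIGMA i:{r<..n}. {1..n + 1 - i})" by (auto simp: nontrivial_positions_def)
  then have "card ?X = (\<Sum>i\<in>{r<..n}. n + 1 - i)" by simp
  moreover have "\<dots> = (\<Sum>i<n - r. n - r - i)"
    by (rule sum.reindex_bij_witness[of _ "\<lambda>i. i + r + 1" "\<lambda>i. i - r - 1"]) auto
  ultimately show ?thesis using length_cells_between[OF D] by (simp add: elbows_below_def)
qed

lemma rc_final_tableau:
  assumes D: "D \<in> RC n"
  defines "T \<equiv> fst (eg_stage (n + 1) D (n + 1))"
  shows "length T = n - 1" "i < n - 1 \<Longrightarrow> T ! i = [i + 3..<n + 2]"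
proof -
  have sub: "D \<subseteq> nontrivial_positions (n + 1)" using D RC_iff_triangulation by blast
  have ex: "has_exits n D" using D has_exits_iff_RC by blast
  have T: "strict_tableau T" unfolding T_def using rc_insertable_stage(2)[OF D] by blast
  \<comment> \<open>The letter 2 could only come from the corner, which holds an elbow.\<close>
  have "3 \<le> z \<and> z \<le> n + 1" if "z \<in> set (concat T)" for z
  proof -
    have "insertable (cell_letters (cells_between (n + 1) D 1 (n + 2))) []"
      using rc_insertable[OF D] by (simp add: reading_order_cells)
    then have "z \<in> set (cell_letters (cells_between (n + 1) D 1 (n + 2)))"
      using insert_letters_entries that unfolding T_def eg_stage_shape(2) by fastforce
    then obtain i j where ij: "(i, j) \<in> D" "z = i + j"
      using set_cells_between[OF sub] by (auto simp: cell_letters_def)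
    then have "(i, j) \<noteq> (1, 1)" "1 \<le> i" "1 \<le> j" "i + j \<le> n + 1"
      using has_exits_corner[OF ex] sub by (auto simp: nontrivial_positions_def)
    then show ?thesis using ij(2) by auto
  qed
  moreover have "sum_list (map length T) = (\<Sum>i<n - 1. n - 1 - i)"
  proof -
    have "length (cells_between (n + 1) D 1 (n + 2)) + n = (\<Sum>i<n. n - i)"
      using card_rows_below[OF sub, of 0] has_exits_turns(1)[OF ex] by (simp add: elbows_below_0)
    moreover have "(\<Sum>i<n. n - i) = (\<Sum>i<n - 1. n - 1 - i) + n"
      by (cases n) (simp_all add: sum.lessThan_Suc_shift del: sum.lessThan_Suc)
    ultimately show ?thesis unfolding T_def eg_stage_shape(3) by simp
  qed
  ultimately show "length T = n - 1" "i < n - 1 \<Longrightarrow> T ! i = [i + 3..<n + 2]"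
    using staircase_tableau[OF T] by blast+
qed

lemma rc_stage_row_bounds:
  assumes D: "D \<in> RC n" and r: "r \<le> n + 1" and i: "i < n - 1"
  shows "length (tab_row (fst (eg_stage (n + 1) D r)) i) \<le> n - 1 - i"
    and "length (tab_row (fst (eg_stage (n + 1) D r)) i) \<le> r"
    and "min (r - 1) (n - 1 - i) \<le> length (tab_row (fst (eg_stage (n + 1) D r)) i)"
proof -
  have sub: "D \<subseteq> nontrivial_positions (n + 1)" using D RC_iff_triangulation by blast
  let ?P = "\<lambda>r. fst (eg_stage (n + 1) D r)"
  have fin: "tab_row (?P (n + 1)) i = [i + 3..<n + 2]"
    using rc_final_tableau[OF D] i by (simp add: tab_row_def)
  show "length (tab_row (?P r) i) \<le> n - 1 - i"
    using eg_stage_tab_row_prefix[OF sub r, of i] unfolding fin by (simp del: upt_Suc)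
  have "length (tab_row (?P r) 0) \<le> r"
    using r
  proof (induction r)
    case 0
    then show ?case by (simp add: eg_stage_def cells_between_def)
  next
    case (Suc r)
    let ?w = "cell_letters (cells_between (n + 1) D (Suc r) (Suc (Suc r)))"
    have "sorted_wrt (>) ?w"
      unfolding cells_between_Suc cell_letters_def
      by (simp add: sorted_wrt_map sorted_wrt_filter sorted_wrt_rev comp_def del: upt_Suc)
    moreover have "insertable ?w (?P r)"
      using rc_insertable_stage(1)[OF D, of r "Suc r"] Suc.prems by simp
    moreover have "?P (Suc r) = insert_letters ?w (?P r)"
      unfolding eg_stage_shape(2) insert_letters_append[symmetric]
      using cells_between_append[of 1 "r + 1" "r + 2" "n + 1" D] by (simp add: cell_letters_def)
    ultimately show ?case using insert_letters_decreasing[of ?w "?P r"] Suc by simp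
  qed
  then show "length (tab_row (?P r) i) \<le> r"
    using length_tab_row_antimono[OF rc_insertable_stage(2)[OF D order_refl r], of 0 i] by simp
  let ?w = "cell_letters (cells_between (n + 1) D (r + 1) (n + 1 + 1))"
  have "insertable ?w (?P r)" using rc_insertable_stage(1)[OF D r] by simp
  moreover have "\<forall>x\<in>set ?w. r + 2 \<le> x"
    using set_cells_between[OF sub] sub by (auto simp: cell_letters_def nontrivial_positions_def)
  moreover have "?P (n + 1) = insert_letters ?w (?P r)"
    unfolding eg_stage_shape(2) insert_letters_append[symmetric]
    using cells_between_append[of 1 "r + 1" "n + 1 + 1" "n + 1" D] r by (simp add: cell_letters_def)
  ultimately have "filter (\<lambda>z. z < r + 2 + i) (tab_row (?P r) i) = filter (\<lambda>z. z < r + 2 + i) [i + 3..<n + 2]"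
    using insert_letters_small_entries[of ?w "?P r" "r + 2" i] fin by simp
  \<comment> \<open>The final row \<open>i\<close> starts with \<open>i + 3\<close>, so
    \<open>r - 1\<close> of its entries are below \<open>r + 2 + i\<close>, unless the row is
    shorter than that.\<close>
  moreover have "length (filter (\<lambda>z. z < r + 2 + i) [i + 3..<n + 2]) = min (r - 1) (n - 1 - i)"
  proof -
    have "length (filter (\<lambda>z. z < r + 2 + i) [i + 3..<n + 2]) = card (set (filter (\<lambda>z. z < r + 2 + i) [i + 3..<n + 2]))"
      by (rule distinct_card[symmetric]) simp
    also have "set (filter (\<lambda>z. z < r + 2 + i) [i + 3..<n + 2]) = {i + 3..<min (n + 2) (r + 2 + i)}" by auto
    finally show ?thesis by simp
  qed
  ultimately show "min (r - 1) (n - 1 - i) \<le> length (tab_row (?P r) i)"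
    by (metis length_filter_le)
qed

text \<open>Column \<open>r\<close> of the insertion tableau, before transposition, holds the letters of row \<open>r\<close> and
  later rows only, and the earlier columns are complete after \<open>r\<close> rows; so its length at that stage
  is a count of crosses.\<close>

lemma rc_stage_column:
  assumes D: "D \<in> RC n" and r: "1 \<le> r" "r \<le> n - 1"
  shows "elbows_below n D r \<le> n - r"
    and "i < n - r \<Longrightarrow> r \<le> length (tab_row (fst (eg_stage (n + 1) D r)) i) \<longleftrightarrow> i < elbows_below n D r"
proof -
  have sub: "D \<subseteq> nontrivial_positions (n + 1)" using D RC_iff_triangulation by blast
  let ?P = "\<lambda>r. fst (eg_stage (n + 1) D r)"
  let ?len = "\<lambda>i. length (tab_row (?P r) i)"
  define H where "H = {i. i < n - r \<and> r \<le> ?len i}"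
  have rn: "r \<le> n + 1" using r by simp
  note b = rc_stage_row_bounds[OF D rn]
  have tab: "strict_tableau (?P r)" using rc_insertable_stage(2)[OF D order_refl rn] .
  have finH: "finite H" by (simp add: H_def)
  have H: "H = {..<card H}"
    by (rule initial_set_eq[OF finH]) (use length_tab_row_antimono[OF tab] in \<open>auto simp: H_def intro: order_trans\<close>)
  \<comment> \<open>A row \<open>i < n - r\<close> has \<open>r - 1\<close> or \<open>r\<close>
    boxes, and \<open>H\<close> collects those with \<open>r\<close>. Every later row is complete,
    and there the truncated \<open>n - r - i\<close> vanishes.\<close>
  have len: "?len i + (n - r - i) = n - 1 - i + of_bool (i \<in> H)" if "i < n - 1" for i
    using b[OF that] r that by (auto simp: H_def)
  have "length (?P r) \<le> n - 1"
  proof (rule ccontr)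
    assume "\<not> ?thesis"
    then have l: "n - 1 < length (?P r)" by simp
    then have "?len (n - 1) \<noteq> 0"
      using strict_tableau_row(1)[OF tab] by (simp add: tab_row_def)
    then show False
      using eg_stage_tab_row_prefix[OF sub rn, of "n - 1"] rc_final_tableau(1)[OF D] by (simp add: tab_row_def)
  qed
  then have "(\<Sum>i<n - 1. ?len i) = length (cells_between (n + 1) D 1 (r + 1))"
    using sum_list_tab_row eg_stage_shape(3) by metis
  moreover have "length (cells_between (n + 1) D 1 (r + 1)) + length (cells_between (n + 1) D (r + 1) (n + 2)) = (\<Sum>i<n - 1. n - 1 - i)"
  proof -
    have "sum_list (map length (?P (n + 1))) = (\<Sum>i<n - 1. length (tab_row (?P (n + 1)) i))"
      by (rule sum_list_tab_row) (rule eq_refl[OF rc_final_tableau(1)[OF D]])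
    also have "\<dots> = (\<Sum>i<n - 1. n - 1 - i)"
      by (rule sum.cong) (use rc_final_tableau[OF D] in \<open>auto simp: tab_row_def\<close>)
    finally show ?thesis
      using cells_between_append[of 1 "r + 1" "n + 2" "n + 1" D] rn
      by (simp add: eg_stage_shape(3))
  qed
  moreover have "(\<Sum>i<n - 1. ?len i) + (\<Sum>i<n - 1. n - r - i) = (\<Sum>i<n - 1. n - 1 - i) + card H"
  proof -
    have "(\<Sum>i<n - 1. ?len i) + (\<Sum>i<n - 1. n - r - i) = (\<Sum>i<n - 1. n - 1 - i + of_bool (i \<in> H))"
      unfolding sum.distrib[symmetric] by (rule sum.cong) (use len in auto)
    also have "\<dots> = (\<Sum>i<n - 1. n - 1 - i) + (\<Sum>i<n - 1. of_bool (i \<in> H))"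
      by (rule sum.distrib)
    also have "(\<Sum>i<n - 1. of_bool (i \<in> H)) = card ({..<n - 1} \<inter> H)"
      by (simp add: sum_of_bool_eq)
    also have "{..<n - 1} \<inter> H = H" using r by (auto simp: H_def)
    finally show ?thesis .
  qed
  moreover have "(\<Sum>i<n - 1. n - r - i) = (\<Sum>i<n - r. n - r - i)"
    by (rule sum.mono_neutral_right) (use r in auto)
  \<comment> \<open>The equations leave for \<open>card H\<close> the number of nontrivial positions
    below row \<open>r\<close> minus the number of crosses there.\<close>
  ultimately have card: "card H = elbows_below n D r"
    using card_rows_below[OF sub, of r] by simp
  have "H \<subseteq> {..<n - r}" by (auto simp: H_def)
  then show "elbows_below n D r \<le> n - r" using card card_mono[of "{..<n - r}" H] by simp
  show "r \<le> ?len i \<longleftrightarrow> i < elbows_below n D r" if "i < n - r"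
    using H card that by (auto simp: H_def)
qed

text \<open>After \<open>c\<close> rows of \<open>D\<close> the row has at most \<open>c\<close>
  boxes, so its box number \<open>c\<close>, counted from 0, has a label of at least
  \<open>c + 1\<close>. The label is \<open>c + 1\<close> exactly if row \<open>c + 1\<close> of
  \<open>D\<close> has already produced the box.\<close>

lemma rc_recording_label:
  assumes D: "D \<in> RC n" and c: "c + i < n - 1"
  shows "tab_row (snd (eg_stage (n + 1) D (n + 1))) i ! c = c + 1 \<longleftrightarrow>
    c + 1 \<le> length (tab_row (fst (eg_stage (n + 1) D (c + 1))) i)"
proof -
  have sub: "D \<subseteq> nontrivial_positions (n + 1)" using D RC_iff_triangulation by blast
  let ?Q = "\<lambda>r. tab_row (snd (eg_stage (n + 1) D r)) i"
  have len: "length (?Q r) = length (tab_row (fst (eg_stage (n + 1) D r)) i)" for r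
    using length_tab_row_cong[OF eg_stage_shape(1)] by metis
  have full: "length (?Q (n + 1)) = n - 1 - i"
    unfolding len using rc_final_tableau[OF D] c by (simp add: tab_row_def del: upt_Suc)
  have short: "length (?Q c) \<le> c"
    unfolding len using rc_stage_row_bounds(2)[OF D, of c i] c by simp
  obtain ys where ys: "?Q (c + 1) = ?Q c @ ys" "\<forall>z\<in>set ys. c < z \<and> z \<le> c + 1"
    by (rule eg_stage_recording[OF sub, of c "c + 1" i]) auto
  obtain zs where zs: "?Q (n + 1) = ?Q (c + 1) @ zs" "\<forall>z\<in>set zs. c + 1 < z \<and> z \<le> n + 1"
    by (rule eg_stage_recording[OF sub, of "c + 1" "n + 1" i]) (use c in auto)
  show ?thesis
  proof (cases "c < length (?Q (c + 1))")
    case True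
    then have "?Q (n + 1) ! c = ys ! (c - length (?Q c))" "c - length (?Q c) < length ys"
      using zs(1) ys(1) short by (auto simp: nth_append)
    then have "?Q (n + 1) ! c \<in> set ys" by simp
    then have "?Q (n + 1) ! c = c + 1" using ys(2) by fastforce
    then show ?thesis using True len by simp
  next
    case False
    then have "?Q (n + 1) ! c = zs ! (c - length (?Q (c + 1)))" "c - length (?Q (c + 1)) < length zs"
      using zs(1) full c by (auto simp: nth_append)
    then have "?Q (n + 1) ! c \<in> set zs" by simp
    then have "?Q (n + 1) ! c \<noteq> c + 1" using zs(2) by fastforce
    then show ?thesis using False len by simp
  qed
qed

lemma row_label_boxes_transpose:
  assumes len: "map length Q = rev [1..<n]"
  shows "row_label_boxes (List.transpose Q) =
    {(r, c). 1 \<le> r \<and> 1 \<le> c \<and> r + c \<le> n \<and> Q ! (c - 1) ! (r - 1) = r}"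
proof -
  have lQ: "length Q = n - 1" using arg_cong[OF len, of length] by simp
  have row: "length (Q ! k) = n - 1 - k" if "k < n - 1" for k
    using arg_cong[OF len, of "\<lambda>l. l ! k"] lQ that by (simp add: rev_nth)
  have s: "sorted (rev (map length Q))" unfolding len by simp
  have lT: "length (List.transpose Q) = n - 1"
    using length_transpose_sorted[OF s] lQ row[of 0] by (cases "n \<le> 1") auto
  have lf: "length (filter (\<lambda>ys. k < length ys) Q) = n - 1 - k" for k
  proof -
    have "{i. i < length Q \<and> k < length (Q ! i)} = {..<n - 1 - k}" using lQ row by auto
    then show ?thesis by (simp add: length_filter_conv_card)
  qed
  have lrow: "length (List.transpose Q ! k) = n - 1 - k" if "k < n - 1" for k
    using nth_transpose[of k Q] lT lf that by simp
  have entry: "List.transpose Q ! k ! l = Q ! l ! k" if "k < n - 1" "l < n - 1 - k" for k l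
    using nth_nth_transpose_sorted[OF s, of k l] lT lf that by simp
  have "(r, c) \<in> row_label_boxes (List.transpose Q) \<longleftrightarrow>
      1 \<le> r \<and> 1 \<le> c \<and> r + c \<le> n \<and> Q ! (c - 1) ! (r - 1) = r" for r c
  proof (cases "1 \<le> r \<and> r \<le> n - 1 \<and> 1 \<le> c")
    case True
    then show ?thesis
      using lT lrow[of "r - 1"] entry[of "r - 1" "c - 1"] by (auto simp: row_label_boxes_def)
  next
    case False
    then show ?thesis using lT by (auto simp: row_label_boxes_def)
  qed
  then show ?thesis by auto
qed

text \<open>In row \<open>r\<close> of the transposed tableau the label \<open>r\<close> marks the
  boxes of column \<open>r\<close> present after \<open>r\<close> rows of \<open>D\<close>. They are
  the first \<open>elbows_below n D r\<close> ones, as many as row \<open>r\<close> of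
  \<open>rc_lambda n D\<close> has.\<close>

lemma row_label_boxes_eq_young_diagram:
  assumes D: "D \<in> RC n"
  shows "row_label_boxes (Q_tableau (n + 1) D) = young_diagram (rc_lambda n D)"
    and "young_diagram (rc_lambda n D) \<subseteq> young_diagram (staircase n)"
proof -
  let ?Q = "snd (eg_stage (n + 1) D (n + 1))"
  have Q: "Q_tableau (n + 1) D = List.transpose ?Q"
    by (simp add: Q_tableau_def EG_def reading_order_cells eg_stage_def split: prod.split)
  have sub: "D \<subseteq> nontrivial_positions (n + 1)" using D RC_iff_triangulation by blast
  have "map length ?Q = map length (fst (eg_stage (n + 1) D (n + 1)))" by (rule eg_stage_shape(1)[symmetric])
  also have "\<dots> = rev [1..<n]"
    by (rule nth_equalityI) (use rc_final_tableau[OF D] in \<open>auto simp: rev_nth\<close>)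
  finally have len: "map length ?Q = rev [1..<n]" .
  have lQ: "length ?Q = n - 1" using arg_cong[OF len, of length] by simp
  have zero: "elbows_below n D r = 0" if "n \<le> r" for r
  proof -
    have "{p \<in> elbows n D. r < fst p} = {}" using that by (auto simp: elbows_def nontrivial_positions_def)
    then show ?thesis by (simp only: elbows_below_def card.empty)
  qed
  have le: "elbows_below n D r \<le> n - r" if "1 \<le> r" for r
    using rc_stage_column(1)[OF D that] zero[of r] by (cases "r \<le> n - 1") auto
  have "(r, c) \<in> row_label_boxes (Q_tableau (n + 1) D) \<longleftrightarrow> (r, c) \<in> young_diagram (rc_lambda n D)" for r c
  proof (cases "1 \<le> r \<and> 1 \<le> c \<and> r + c \<le> n")
    case True
    then have ij: "c - 1 < n - r" "r - 1 + (c - 1) < n - 1" "r \<le> n - 1" "c - 1 < length ?Q" using lQ by auto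
    have "?Q ! (c - 1) ! (r - 1) = r \<longleftrightarrow> c - 1 < elbows_below n D r"
      using rc_recording_label[OF D ij(2)] rc_stage_column(2)[OF D _ ij(3,1)] True ij(4)
      by (simp add: tab_row_def)
    then show ?thesis
      unfolding Q row_label_boxes_transpose[OF len] young_diagram_rc_lambda using True by auto
  next
    case False
    then show ?thesis
      unfolding Q row_label_boxes_transpose[OF len] young_diagram_rc_lambda using le[of r] by auto
  qed
  then show "row_label_boxes (Q_tableau (n + 1) D) = young_diagram (rc_lambda n D)" by auto
  show "young_diagram (rc_lambda n D) \<subseteq> young_diagram (staircase n)"
    unfolding young_diagram_rc_lambda
  proof (clarify)
    fix r c :: nat assume "1 \<le> r" "1 \<le> c" "c \<le> elbows_below n D r"
    moreover from this have "c \<le> n - r" using le[of r] by simp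
    ultimately show "(r, c) \<in> young_diagram (staircase n)"
      by (auto simp: young_diagram_def staircase_def rev_nth)
  qed
qed

theorem proposition4:
  fixes n :: nat
  assumes "n \<ge> 1"
  shows "bij_betw (rc_lambda n) (RC n) (partitions_in_staircase n)
    \<and> bij_betw (rc_mu n) (RC n) (partitions_in_staircase n)
    \<and> (\<forall>D\<in>RC n. young_diagram (rc_mu n D) = row_label_boxes (Q_tableau (n + 1) D))
    \<and> (\<forall>D\<in>RC n. rc_lambda n D = rc_mu n D)"
proof -
  \<comment> \<open>\<open>rc_lambda n D\<close> satisfies the description in \<open>rc_mu\<close>,
    uniquely since a diagram determines its partition. Bijectivity of \<open>rc_mu\<close> is then
    inherited.\<close>
  have mu: "rc_mu n D = rc_lambda n D" if "D \<in> RC n" for D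
    unfolding rc_mu_def row_label_boxes_eq_young_diagram(1)[OF that]
    using is_partition_rc_lambda young_diagram_inject by (intro the_equality) auto
  have "rc_lambda n ` RC n = partitions_in_staircase n"
  proof (intro equalityI subsetI)
    fix p assume "p \<in> rc_lambda n ` RC n"
    then show "p \<in> partitions_in_staircase n"
      using row_label_boxes_eq_young_diagram(2) is_partition_rc_lambda
      unfolding partitions_in_staircase_def by blast
  next
    fix p assume "p \<in> partitions_in_staircase n"
    then show "p \<in> rc_lambda n ` RC n" using rc_lambda_surj by blast
  qed
  then have "bij_betw (rc_lambda n) (RC n) (partitions_in_staircase n)"
    using rc_lambda_inj by (simp add: bij_betw_def)
  moreover from this have "bij_betw (rc_mu n) (RC n) (partitions_in_staircase n)"
    using bij_betw_cong[of "RC n" "rc_mu n" "rc_lambda n"] mu by simp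
  ultimately show ?thesis using mu row_label_boxes_eq_young_diagram(1) by simp
qed

end
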